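(* Let $\zeta=(P,B,\Delta_P)$ be a quantum principal $\mathcal G$-bundle with a differential calculus and let $\mathfrak F\in\mathfrak{qGG}$ be a quantum gauge transformation. Then for every quantum principal connection $\omega$ on $\zeta$: (1) the linear map $\mathfrak F^{\circledast}\omega:=\mathfrak F\circ\omega$ is again a quantum principal connection, and this defines a group action of $\mathfrak{qGG}$ on the set $\mathfrak{qpc}(\zeta)$ of all quantum principal connections; (2) if $\mathfrak F$ preserves the $\ast$ operation, then $\mathfrak F^{\circledast}\omega$ is real if and only if $\omega$ is real; (3) if $\mathfrak F$ is a graded algebra morphism, then $\mathfrak F^{\circledast}\omega$ is regular when $\omega$ is regular; (4) if $\mathfrak F$ is a graded algebra morphism, then $\mathfrak F^{\circledast}\omega$ is multiplicative when $\omega$ is multiplicative.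
   Context: All algebras are associative unital $\ast$-algebras over $\mathbb C$. $\mathcal G$ is a compact matrix quantum group (Woronowicz) with dense $\ast$-Hopf algebra $(H,\Delta,\epsilon,S,\ast)$; Sweedler notation is used. A corepresentation is a linear map $\delta^V:V\to V\otimes H$ with $(\mathrm{id}\otimes\epsilon)\delta^V=\mathrm{id}$, $(\mathrm{id}\otimes\Delta)\delta^V=(\delta^V\otimes\mathrm{id})\delta^V$. A quantum principal $\mathcal G$-bundle (qpb) $\zeta=(P,B,\Delta_P)$: a $\ast$-algebra $P$, a $\ast$-subalgebra $B$, and a $\ast$-algebra morphism $\Delta_P:P\to P\otimes H$ that is a corepresentation, such that $\Delta_P(x)=x\otimes 1$ iff $x\in B$, and $x\otimes y\mapsto (x\otimes 1)\Delta_P(y)$ maps $P\otimes P$ onto $P\otimes H$. Standing assumption: $B$ can be completed to a $C^\ast$-algebra. Graded differential $\ast$-algebras have $d(w^\ast)=(dw)^\ast$, $(wv)^\ast=(-1)^{kl}v^\ast w^\ast$ for degrees $k,l$, and tensor products are graded. Let $(\Gamma,d)$ be a bicovariant first-order differential $\ast$-calculus over $H$, $\mathfrak{qg}^\#\subset\Gamma$ its space of left-invariant elements, $\pi:H\to\mathfrak{qg}^\#$, $\pi(g)=S(g^{(1)})dg^{(2)}$ (surjective), $\mathcal R=\ker\pi\cap\ker\epsilon$ (so $\mathfrak{qg}^\#\cong\ker\epsilon/\mathcal R$), $\mathrm{ad}:\mathfrak{qg}^\#\to\mathfrak{qg}^\#\otimes H$ the corepresentation with $\mathrm{ad}(\pi(g))=\pi(g^{(2)})\otimes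 S(g^{(1)})g^{(3)}$, and $\pi(h)\diamondsuit g=\pi(hg-\epsilon(h)g)$ the right $H$-action on $\mathfrak{qg}^\#$. $\Gamma^\wedge$ is the universal differential envelope: the quotient of $\bigoplus_k\Gamma^{\otimes_H k}$ by the two-sided ideal generated by $\sum_i dg_i\otimes_H dh_i$ whenever $\sum_i g_i\,dh_i=0$; $\Delta$ extends to a graded differential $\ast$-morphism $\Gamma^\wedge\to\Gamma^\wedge\otimes\Gamma^\wedge$. A differential calculus on $\zeta$: such a $(\Gamma,d)$ together with a graded differential $\ast$-algebra $\Omega^\bullet(P)$ generated by $\Omega^0(P)=P$ such that $\Delta_P$ extends to a graded differential $\ast$-algebra morphism $\Delta_{\Omega^\bullet(P)}:\Omega^\bullet(P)\to\Omega^\bullet(P)\otimes\Gamma^\wedge$. $\mathrm{Hor}^\bullet P=\{\varphi:\Delta_{\Omega^\bullet(P)}(\varphi)\in\Omega^\bullet(P)\otimes H\}$, with $\Delta_{\mathrm{Hor}}=\Delta_{\Omega^\bullet(P)}|_{\mathrm{Hor}^\bullet P}$, $\varphi\mapsto\varphi^{(0)}\otimes\varphi^{(1)}$. $\Omega^\bullet(B)=\{\mu\in\Omega^\bullet(P):\Delta_{\Omega^\bullet(P)}(\mu)=\mu\otimes1\}$. A quantum principal connection (qpc) is a linear map $\omega:\mathfrak{qg}^\#\to\Omega^1(P)$ with $\Delta_{\Omega^\bullet(P)}(\omega(\theta))=(\omega\otimes\mathrm{id}_H)\mathrm{ad}(\theta)+1\otimes\theta$. It is real if $\omega(\theta^\ast)=\omega(\theta)^\ast$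 for all $\theta$; regular if $\omega(\theta)\varphi=(-1)^k\varphi^{(0)}\omega(\theta\diamondsuit\varphi^{(1)})$ for all $\theta$ and $\varphi\in\mathrm{Hor}^kP$; multiplicative if $\omega(\pi(g^{(1)}))\omega(\pi(g^{(2)}))=0$ for all $g\in\mathcal R$. The quantum gauge group $\mathfrak{qGG}$ is the group of all graded left $\Omega^\bullet(B)$-module isomorphisms $\mathfrak F:\Omega^\bullet(P)\to\Omega^\bullet(P)$ with $\mathfrak F(1)=1$ and $(\mathfrak F\otimes\mathrm{id}_{\Gamma^\wedge})\circ\Delta_{\Omega^\bullet(P)}=\Delta_{\Omega^\bullet(P)}\circ\mathfrak F$, with group product $(\mathfrak F_1\cdot\mathfrak F_2)(w)=\mathfrak F_2(\mathfrak F_1(w))$ (so the action in (1) is a right action). Its elements are called quantum gauge transformations. *)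

theory Defs
  imports Complex_Main "HOL-Library.Poly_Mapping" "HOL-Algebra.Group"
begin

section \<open>Complex vector spaces and algebras\<close>

class complex_vector = ab_group_add +
  fixes scaleC :: "complex \<Rightarrow> 'a \<Rightarrow> 'a" (infixr \<open>*\<^sub>C\<close> 75)
  assumes scaleC_add_right: "c *\<^sub>C (x + y) = c *\<^sub>C x + c *\<^sub>C y"
    and scaleC_add_left: "(b + c) *\<^sub>C x = b *\<^sub>C x + c *\<^sub>C x"
    and scaleC_scaleC: "b *\<^sub>C (c *\<^sub>C x) = (b * c) *\<^sub>C x"
    and scaleC_one: "1 *\<^sub>C x = x"

text \<open>Associative unital algebras; the zero algebra is not excluded.\<close>

class complex_algebra = complex_vector + ring + monoid_mult +
  assumes scaleC_mult_left: "(c *\<^sub>C x) * y = c *\<^sub>C (x * y)"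
    and scaleC_mult_right: "x * (c *\<^sub>C y) = c *\<^sub>C (x * y)"

global_interpretation cvec: vector_space "scaleC :: complex \<Rightarrow> 'a \<Rightarrow> 'a::complex_vector"
  by unfold_locales (simp_all add: scaleC_add_right scaleC_add_left scaleC_scaleC scaleC_one)

abbreviation clinear :: "('a::complex_vector \<Rightarrow> 'b::complex_vector) \<Rightarrow> bool"
  where "clinear \<equiv> Vector_Spaces.linear scaleC scaleC"

abbreviation csubspace :: "'a::complex_vector set \<Rightarrow> bool"
  where "csubspace \<equiv> module.subspace scaleC"

abbreviation cspan :: "'a::complex_vector set \<Rightarrow> 'a set"
  where "cspan \<equiv> module.span scaleC"

lemma clinear_iff:
  "clinear f \<longleftrightarrow> (\<forall>x y. f (x + y) = f x + f y) \<and> (\<forall>c x. f (c *\<^sub>C x) = c *\<^sub>C f x)"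
  by (auto simp: Vector_Spaces.linear_iff cvec.vector_space_axioms)

definition antilinear :: "('a::complex_vector \<Rightarrow> 'b::complex_vector) \<Rightarrow> bool"
  where "antilinear f \<longleftrightarrow>
    (\<forall>x y. f (x + y) = f x + f y) \<and> (\<forall>c x. f (c *\<^sub>C x) = cnj c *\<^sub>C f x)"

definition cbilinear :: "('a::complex_vector \<Rightarrow> 'b::complex_vector \<Rightarrow> 'c::complex_vector) \<Rightarrow> bool"
  where "cbilinear \<beta> \<longleftrightarrow> (\<forall>a. clinear (\<beta> a)) \<and> (\<forall>b. clinear (\<lambda>a. \<beta> a b))"

instantiation complex :: complex_algebra
begin
definition scaleC_complex :: "complex \<Rightarrow> complex \<Rightarrow> complex"
  where "scaleC_complex = (*)"
instance
  by standard (simp_all add: scaleC_complex_def algebra_simps)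
end

instantiation poly_mapping :: (type, complex_vector) complex_vector
begin
definition scaleC_poly_mapping :: "complex \<Rightarrow> ('a \<Rightarrow>\<^sub>0 'b) \<Rightarrow> ('a \<Rightarrow>\<^sub>0 'b)"
  where "scaleC_poly_mapping c p = Poly_Mapping.map (scaleC c) p"

lemma lookup_scaleC [simp]: "Poly_Mapping.lookup (c *\<^sub>C p) k = c *\<^sub>C Poly_Mapping.lookup p k"
  by (simp add: scaleC_poly_mapping_def Poly_Mapping.map.rep_eq when_def)

instance
  by standard
    (auto intro!: poly_mapping_eqI simp: lookup_add scaleC_add_right scaleC_add_left scaleC_scaleC scaleC_one)
end

text \<open>
  Formal complex combinations of elements of \<open>'x\<close> are elements of \<open>'x \<Rightarrow>\<^sub>0 complex\<close>.  The next
  function extends \<open>\<beta>\<close> to them; the coefficients are first passed through \<open>\<kappa>\<close>, which is either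
  the identity or complex conjugation.
\<close>

definition formal_sum ::
    "(complex \<Rightarrow> complex) \<Rightarrow> ('x \<Rightarrow> 'c::complex_vector) \<Rightarrow> ('x \<Rightarrow>\<^sub>0 complex) \<Rightarrow> 'c"
  where "formal_sum \<kappa> \<beta> p = (\<Sum>x\<in>Poly_Mapping.keys p. \<kappa> (Poly_Mapping.lookup p x) *\<^sub>C \<beta> x)"

abbreviation gen :: "'x \<Rightarrow> ('x \<Rightarrow>\<^sub>0 complex)"
  where "gen x \<equiv> Poly_Mapping.single x 1"

lemma formal_sum_superset:
  assumes "\<kappa> 0 = 0" "finite A" "Poly_Mapping.keys p \<subseteq> A"
  shows "formal_sum \<kappa> \<beta> p = (\<Sum>x\<in>A. \<kappa> (Poly_Mapping.lookup p x) *\<^sub>C \<beta> x)"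
  unfolding formal_sum_def
  by (rule sum.mono_neutral_left) (use assms in \<open>auto simp: in_keys_iff\<close>)

lemma formal_sum_add:
  assumes "\<And>x y. \<kappa> (x + y) = \<kappa> x + \<kappa> y"
  shows "formal_sum \<kappa> \<beta> (p + q) = formal_sum \<kappa> \<beta> p + formal_sum \<kappa> \<beta> q"
proof -
  let ?A = "Poly_Mapping.keys p \<union> Poly_Mapping.keys q"
  have 0: "\<kappa> 0 = 0"
    using assms[of 0 0] by simp
  have "Poly_Mapping.keys (p + q) \<subseteq> ?A"
    by (rule keys_add)
  then show ?thesis
    by (simp add: formal_sum_superset[where \<kappa> = \<kappa> and A = ?A, OF 0] lookup_add assms scaleC_add_left
        sum.distrib)
qed

lemma formal_sum_scaleC:
  assumes "\<kappa> 0 = 0" "\<And>x y. \<kappa> (x * y) = \<kappa> x * \<kappa> y"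
  shows "formal_sum \<kappa> \<beta> (c *\<^sub>C p) = \<kappa> c *\<^sub>C formal_sum \<kappa> \<beta> p"
proof -
  have "Poly_Mapping.keys (c *\<^sub>C p) \<subseteq> Poly_Mapping.keys p"
    by (auto simp: in_keys_iff)
  then show ?thesis
    by (simp add: formal_sum_superset[where \<kappa> = \<kappa> and A = "Poly_Mapping.keys p", OF assms(1)] assms(2)
        scaleC_complex_def cvec.scale_sum_right scaleC_scaleC)
qed

lemma formal_sum_single: "\<kappa> 0 = 0 \<Longrightarrow> formal_sum \<kappa> \<beta> (Poly_Mapping.single x c) = \<kappa> c *\<^sub>C \<beta> x"
  by (simp add: formal_sum_def)

section \<open>Tensor products over the complex numbers\<close>

definition tensor_relations :: "(('a::complex_vector \<times> 'b::complex_vector) \<Rightarrow>\<^sub>0 complex) set"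
  where "tensor_relations =
      {gen (a + a', b) - gen (a, b) - gen (a', b) | a a' b. True}
    \<union> {gen (a, b + b') - gen (a, b) - gen (a, b') | a b b'. True}
    \<union> {gen (c *\<^sub>C a, b) - c *\<^sub>C gen (a, b) | c a b. True}
    \<union> {gen (a, c *\<^sub>C b) - c *\<^sub>C gen (a, b) | c a b. True}"

definition tensor_eq ::
    "(('a::complex_vector \<times> 'b::complex_vector) \<Rightarrow>\<^sub>0 complex) \<Rightarrow> ('a \<times> 'b \<Rightarrow>\<^sub>0 complex) \<Rightarrow> bool"
  where "tensor_eq p q \<longleftrightarrow> p - q \<in> cspan tensor_relations"

quotient_type (overloaded) ('a, 'b) tensor =
    "('a::complex_vector \<times> 'b::complex_vector) \<Rightarrow>\<^sub>0 complex" / tensor_eq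
proof (rule equivpI)
  show "reflp tensor_eq"
    by (simp add: reflp_def tensor_eq_def cvec.span_zero)
  show "symp tensor_eq"
    by (metis (no_types, lifting) symp_def tensor_eq_def cvec.span_neg minus_diff_eq)
  show "transp tensor_eq"
    by (rule transpI) (metis (no_types, lifting) tensor_eq_def cvec.span_add diff_add_cancel add_diff_eq)
qed

instantiation tensor :: (complex_vector, complex_vector) complex_vector
begin
lift_definition zero_tensor :: "('a, 'b) tensor" is 0 .
lift_definition plus_tensor :: "('a, 'b) tensor \<Rightarrow> ('a, 'b) tensor \<Rightarrow> ('a, 'b) tensor" is "(+)"
  unfolding tensor_eq_def by (metis (no_types, lifting) add_diff_add cvec.span_add)
lift_definition uminus_tensor :: "('a, 'b) tensor \<Rightarrow> ('a, 'b) tensor" is "uminus"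
  unfolding tensor_eq_def by (metis (no_types, lifting) minus_diff_minus cvec.span_neg)
lift_definition minus_tensor :: "('a, 'b) tensor \<Rightarrow> ('a, 'b) tensor \<Rightarrow> ('a, 'b) tensor" is "(-)"
  unfolding tensor_eq_def
  by (metis (no_types, lifting) add_diff_add cvec.span_add diff_conv_add_uminus minus_diff_minus cvec.span_neg)
lift_definition scaleC_tensor :: "complex \<Rightarrow> ('a, 'b) tensor \<Rightarrow> ('a, 'b) tensor" is "scaleC"
  unfolding tensor_eq_def by (metis (no_types, lifting) cvec.scale_right_diff_distrib cvec.span_scale)
instance
  by standard
    (transfer, simp add: tensor_eq_def cvec.span_zero scaleC_add_left scaleC_add_right scaleC_scaleC
      scaleC_one algebra_simps)+
end

lift_definition tens :: "'a::complex_vector \<Rightarrow> 'b::complex_vector \<Rightarrow> ('a, 'b) tensor"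
  (infixr \<open>\<otimes>\<^sub>C\<close> 72) is "\<lambda>a b. gen (a, b)" .

text \<open>
  \<open>tensor_sum \<kappa> \<beta> t\<close> evaluates \<open>\<Sum>\<^sub>i \<kappa> c\<^sub>i \<beta> a\<^sub>i b\<^sub>i\<close> on a representative
  \<open>\<Sum>\<^sub>i c\<^sub>i (a\<^sub>i \<otimes> b\<^sub>i)\<close> of \<open>t\<close>.  It is independent of the representative when \<open>\<beta>\<close> is bilinear and
  \<open>\<kappa> = id\<close>, and when \<open>\<beta>\<close> is antilinear in both arguments and \<open>\<kappa> = cnj\<close>; only these cases are used.
\<close>

definition tensor_sum :: "(complex \<Rightarrow> complex) \<Rightarrow>
    ('a::complex_vector \<Rightarrow> 'b::complex_vector \<Rightarrow> 'c::complex_vector) \<Rightarrow> ('a, 'b) tensor \<Rightarrow> 'c"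
  where "tensor_sum \<kappa> \<beta> t = formal_sum \<kappa> (\<lambda>(a, b). \<beta> a b) (rep_tensor t)"

definition tensor_lift ::
    "('a::complex_vector \<Rightarrow> 'b::complex_vector \<Rightarrow> 'c::complex_vector) \<Rightarrow> ('a, 'b) tensor \<Rightarrow> 'c"
  where "tensor_lift = tensor_sum id"

definition tensor_map :: "('a::complex_vector \<Rightarrow> 'c::complex_vector) \<Rightarrow>
    ('b::complex_vector \<Rightarrow> 'd::complex_vector) \<Rightarrow> ('a, 'b) tensor \<Rightarrow> ('c, 'd) tensor"
  where "tensor_map f g = tensor_lift (\<lambda>a b. f a \<otimes>\<^sub>C g b)"

definition tensor_antimap :: "('a::complex_vector \<Rightarrow> 'c::complex_vector) \<Rightarrow>
    ('b::complex_vector \<Rightarrow> 'd::complex_vector) \<Rightarrow> ('a, 'b) tensor \<Rightarrow> ('c, 'd) tensor"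
  where "tensor_antimap f g = tensor_sum cnj (\<lambda>a b. f a \<otimes>\<^sub>C g b)"

definition tensor_map2 :: "('a::complex_vector \<Rightarrow> 'c::complex_vector \<Rightarrow> 'e::complex_vector) \<Rightarrow>
    ('b::complex_vector \<Rightarrow> 'd::complex_vector \<Rightarrow> 'f::complex_vector) \<Rightarrow>
    ('a, 'b) tensor \<Rightarrow> ('c, 'd) tensor \<Rightarrow> ('e, 'f) tensor"
  where "tensor_map2 f g s t =
    tensor_lift (\<lambda>a b. tensor_lift (\<lambda>c d. f a c \<otimes>\<^sub>C g b d) t) s"

definition tensor_assoc :: "(('a::complex_vector, 'b::complex_vector) tensor, 'c::complex_vector) tensor
    \<Rightarrow> ('a, ('b, 'c) tensor) tensor"
  where "tensor_assoc = tensor_lift (\<lambda>s c. tensor_lift (\<lambda>a b. a \<otimes>\<^sub>C (b \<otimes>\<^sub>C c)) s)"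

lemma tens_add_left: "(a + a') \<otimes>\<^sub>C b = a \<otimes>\<^sub>C b + a' \<otimes>\<^sub>C b"
proof (transfer, unfold tensor_eq_def)
  fix a a' :: 'a and b :: 'b
  have "gen (a + a', b) - gen (a, b) - gen (a', b) \<in> tensor_relations"
    unfolding tensor_relations_def by blast
  from cvec.span_base[OF this]
  show "gen (a + a', b) - (gen (a, b) + gen (a', b)) \<in> cspan tensor_relations"
    by (simp add: diff_diff_eq)
qed

lemma tens_add_right: "a \<otimes>\<^sub>C (b + b') = a \<otimes>\<^sub>C b + a \<otimes>\<^sub>C b'"
proof (transfer, unfold tensor_eq_def)
  fix a :: 'a and b b' :: 'b
  have "gen (a, b + b') - gen (a, b) - gen (a, b') \<in> tensor_relations"
    unfolding tensor_relations_def by blast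
  from cvec.span_base[OF this]
  show "gen (a, b + b') - (gen (a, b) + gen (a, b')) \<in> cspan tensor_relations"
    by (simp add: diff_diff_eq)
qed

lemma tens_scale_left: "(c *\<^sub>C a) \<otimes>\<^sub>C b = c *\<^sub>C (a \<otimes>\<^sub>C b)"
  by (transfer, unfold tensor_eq_def, rule cvec.span_base) (unfold tensor_relations_def, blast)

lemma tens_scale_right: "a \<otimes>\<^sub>C (c *\<^sub>C b) = c *\<^sub>C (a \<otimes>\<^sub>C b)"
  by (transfer, unfold tensor_eq_def, rule cvec.span_base) (unfold tensor_relations_def, blast)

lemma cbilinear_tens: "cbilinear (\<otimes>\<^sub>C)"
  by (simp add: cbilinear_def clinear_iff tens_add_left tens_add_right tens_scale_left tens_scale_right)

lemma formal_sum_cong: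
  assumes \<kappa>: "\<kappa> 1 = 1" "\<And>x y. \<kappa> (x + y) = \<kappa> x + \<kappa> y" "\<And>x y. \<kappa> (x * y) = \<kappa> x * \<kappa> y"
    and \<beta>: "\<And>a a' b. \<beta> (a + a') b = \<beta> a b + \<beta> a' b" "\<And>a b b'. \<beta> a (b + b') = \<beta> a b + \<beta> a b'"
      "\<And>c a b. \<beta> (c *\<^sub>C a) b = \<kappa> c *\<^sub>C \<beta> a b" "\<And>c a b. \<beta> a (c *\<^sub>C b) = \<kappa> c *\<^sub>C \<beta> a b"
    and "tensor_eq p q"
  shows "formal_sum \<kappa> (\<lambda>(a, b). \<beta> a b) p = formal_sum \<kappa> (\<lambda>(a, b). \<beta> a b) q"
proof -
  let ?\<Phi> = "formal_sum \<kappa> (\<lambda>(a, b). \<beta> a b)"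
  have 0: "\<kappa> 0 = 0"
    using \<kappa>(2)[of 0 0] by simp
  have add: "?\<Phi> (p + q) = ?\<Phi> p + ?\<Phi> q" for p q
    by (rule formal_sum_add) (rule \<kappa>)
  have diff: "?\<Phi> (p - q) = ?\<Phi> p - ?\<Phi> q" for p q
    using add[of "p - q" q] by (simp add: eq_diff_eq)
  have scale: "?\<Phi> (c *\<^sub>C p) = \<kappa> c *\<^sub>C ?\<Phi> p" for c p
    by (rule formal_sum_scaleC) (rule 0 \<kappa>)+
  have single: "?\<Phi> (gen (a, b)) = \<beta> a b" for a b
    by (simp add: formal_sum_single 0 \<kappa> scaleC_one)
  have rel: "?\<Phi> r = 0" if "r \<in> tensor_relations" for r
    using that unfolding tensor_relations_def
    by (auto simp: diff scale single \<beta>)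
  have "?\<Phi> r = 0" if "r \<in> cspan tensor_relations" for r
    using that
  proof (induction rule: cvec.span_induct_alt)
    case base
    then show ?case by (simp add: formal_sum_def)
  next
    case (step c x y)
    then show ?case by (simp add: add scale rel)
  qed
  then have "?\<Phi> (p - q) = 0"
    using assms(8) by (simp add: tensor_eq_def)
  then show ?thesis by (simp add: diff)
qed

lemma tensor_sum_abs:
  assumes \<kappa>: "\<kappa> 1 = 1" "\<And>x y. \<kappa> (x + y) = \<kappa> x + \<kappa> y" "\<And>x y. \<kappa> (x * y) = \<kappa> x * \<kappa> y"
    and \<beta>: "\<And>a a' b. \<beta> (a + a') b = \<beta> a b + \<beta> a' b" "\<And>a b b'. \<beta> a (b + b') = \<beta> a b + \<beta> a b'"
      "\<And>c a b. \<beta> (c *\<^sub>C a) b = \<kappa> c *\<^sub>C \<beta> a b" "\<And>c a b. \<beta> a (c *\<^sub>C b) = \<kappa> c *\<^sub>C \<beta> a b"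
  shows "tensor_sum \<kappa> \<beta> (abs_tensor p) = formal_sum \<kappa> (\<lambda>(a, b). \<beta> a b) p"
  unfolding tensor_sum_def
  by (rule formal_sum_cong[OF assms]) (rule Quotient3_rep_abs[OF Quotient3_tensor], simp add: tensor_eq_def cvec.span_zero)

lemma tensor_sum_semilinear:
  assumes \<kappa>: "\<kappa> 1 = 1" "\<And>x y. \<kappa> (x + y) = \<kappa> x + \<kappa> y" "\<And>x y. \<kappa> (x * y) = \<kappa> x * \<kappa> y"
    and \<beta>: "\<And>a a' b. \<beta> (a + a') b = \<beta> a b + \<beta> a' b" "\<And>a b b'. \<beta> a (b + b') = \<beta> a b + \<beta> a b'"
      "\<And>c a b. \<beta> (c *\<^sub>C a) b = \<kappa> c *\<^sub>C \<beta> a b" "\<And>c a b. \<beta> a (c *\<^sub>C b) = \<kappa> c *\<^sub>C \<beta> a b"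
  shows tensor_sum_add: "tensor_sum \<kappa> \<beta> (s + t) = tensor_sum \<kappa> \<beta> s + tensor_sum \<kappa> \<beta> t"
    and tensor_sum_scaleC: "tensor_sum \<kappa> \<beta> (c *\<^sub>C t) = \<kappa> c *\<^sub>C tensor_sum \<kappa> \<beta> t"
    and tensor_sum_tens: "tensor_sum \<kappa> \<beta> (a \<otimes>\<^sub>C b) = \<beta> a b"
proof -
  note abs = tensor_sum_abs[of \<kappa> \<beta>, OF assms]
  have 0: "\<kappa> 0 = 0"
    using \<kappa>(2)[of 0 0] by simp
  show "tensor_sum \<kappa> \<beta> (s + t) = tensor_sum \<kappa> \<beta> s + tensor_sum \<kappa> \<beta> t"
  proof (induct s, induct t)
    fix p q
    show "tensor_sum \<kappa> \<beta> (abs_tensor q + abs_tensor p)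
        = tensor_sum \<kappa> \<beta> (abs_tensor q) + tensor_sum \<kappa> \<beta> (abs_tensor p)"
      by (simp add: plus_tensor.abs_eq abs formal_sum_add \<kappa>)
  qed
  show "tensor_sum \<kappa> \<beta> (c *\<^sub>C t) = \<kappa> c *\<^sub>C tensor_sum \<kappa> \<beta> t"
    by (induct t) (simp add: scaleC_tensor.abs_eq abs formal_sum_scaleC \<kappa> 0)
  show "tensor_sum \<kappa> \<beta> (a \<otimes>\<^sub>C b) = \<beta> a b"
    by (simp add: tens.abs_eq abs formal_sum_single \<kappa> 0 scaleC_one)
qed

lemma tensor_lift_tens: "cbilinear \<beta> \<Longrightarrow> tensor_lift \<beta> (a \<otimes>\<^sub>C b) = \<beta> a b"
  unfolding tensor_lift_def by (rule tensor_sum_tens) (auto simp: cbilinear_def clinear_iff)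

lemma clinear_tensor_lift: "cbilinear \<beta> \<Longrightarrow> clinear (tensor_lift \<beta>)"
  unfolding tensor_lift_def clinear_iff
  by (auto simp: cbilinear_def clinear_iff intro!: tensor_sum_add tensor_sum_scaleC[where \<kappa> = id, simplified])

lemma tensor_induct [case_names tens add]:
  assumes "\<And>a b. P (a \<otimes>\<^sub>C b)" "\<And>s t. P s \<Longrightarrow> P t \<Longrightarrow> P (s + t)"
  shows "P t"
proof (induct t)
  have single: "P (abs_tensor (Poly_Mapping.single k v))" for k :: "'a \<times> 'b" and v
  proof -
    have "abs_tensor (Poly_Mapping.single k v) = (v *\<^sub>C fst k) \<otimes>\<^sub>C snd k"
      by (subst tens_scale_left)
        (simp add: tens.abs_eq scaleC_tensor.abs_eq scaleC_poly_mapping_def scaleC_complex_def)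
    then show ?thesis using assms(1) by simp
  qed
  fix p :: "('a \<times> 'b) \<Rightarrow>\<^sub>0 complex"
  show "P (abs_tensor p)"
  proof (induct p rule: update_induct)
    case const
    show ?case using single[of undefined 0] by simp
  next
    case (update f k v)
    have "Poly_Mapping.update k v f = f + Poly_Mapping.single k v"
      using update(1)
      by (intro poly_mapping_eqI) (auto simp: lookup_update lookup_add lookup_single in_keys_iff when_def)
    then show ?case
      using assms(2)[OF update(3) single[of k v]] by (simp add: plus_tensor.abs_eq)
  qed
qed

lemma cbilinear_tensor_map2_inner:
  assumes "cbilinear f" "cbilinear g"
  shows "cbilinear (\<lambda>c d. f a c \<otimes>\<^sub>C g b d)"
  using assms
  by (auto simp: cbilinear_def clinear_iff tens_add_left tens_add_right tens_scale_left tens_scale_right)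

lemma tensor_map2_linear_right:
  assumes "cbilinear f" "cbilinear g"
  shows "clinear (tensor_lift (\<lambda>c d. f a c \<otimes>\<^sub>C g b d))"
  by (rule clinear_tensor_lift) (rule cbilinear_tensor_map2_inner[OF assms])

lemma tensor_map2_outer:
  assumes "cbilinear f" "cbilinear g"
  shows "cbilinear (\<lambda>a b. tensor_lift (\<lambda>c d. f a c \<otimes>\<^sub>C g b d) t)"
proof (induct t rule: tensor_induct)
  case (tens c d)
  show ?case
    unfolding tensor_lift_tens[OF cbilinear_tensor_map2_inner[OF assms]]
    using assms
    by (simp add: cbilinear_def clinear_iff tens_add_left tens_add_right tens_scale_left tens_scale_right)
next
  case (add s t)
  have "tensor_lift (\<lambda>c d. f a c \<otimes>\<^sub>C g b d) (s + t) =
      tensor_lift (\<lambda>c d. f a c \<otimes>\<^sub>C g b d) s + tensor_lift (\<lambda>c d. f a c \<otimes>\<^sub>C g b d) t" for a b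
    using tensor_map2_linear_right[OF assms] by (simp add: clinear_iff)
  then show ?case
    using add by (simp add: cbilinear_def clinear_iff scaleC_add_right algebra_simps)
qed

lemma tensor_map2_tens:
  assumes "cbilinear f" "cbilinear g"
  shows "tensor_map2 f g (a \<otimes>\<^sub>C b) (c \<otimes>\<^sub>C d) = f a c \<otimes>\<^sub>C g b d"
  unfolding tensor_map2_def
  by (subst tensor_lift_tens[OF tensor_map2_outer[OF assms]])
    (rule tensor_lift_tens[OF cbilinear_tensor_map2_inner[OF assms]])

lemma cbilinear_tensor_map2:
  assumes "cbilinear f" "cbilinear g"
  shows "cbilinear (tensor_map2 f g)"
  unfolding cbilinear_def
proof (intro conjI allI)
  show "clinear (\<lambda>s. tensor_map2 f g s t)" for t
    unfolding tensor_map2_def by (rule clinear_tensor_lift) (rule tensor_map2_outer[OF assms])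
  then have left: "tensor_map2 f g (s + s') t = tensor_map2 f g s t + tensor_map2 f g s' t" for s s' t
    by (simp add: clinear_iff)
  show "clinear (tensor_map2 f g s)" for s
  proof (induct s rule: tensor_induct)
    case (tens a b)
    show ?case
      unfolding tensor_map2_def tensor_lift_tens[OF tensor_map2_outer[OF assms]]
      by (rule tensor_map2_linear_right[OF assms])
  next
    case (add s s')
    then show ?case by (simp add: clinear_iff left scaleC_add_right)
  qed
qed

lemma cbilinear_times: "cbilinear ((*) :: 'a::complex_algebra \<Rightarrow> 'a \<Rightarrow> 'a)"
  by (simp add: cbilinear_def clinear_iff algebra_simps scaleC_mult_left scaleC_mult_right)

text \<open>
  The product \<open>*\<close> on a tensor product of algebras is the ungraded one,
  \<open>(a \<otimes> b)(c \<otimes> d) = ac \<otimes> bd\<close>.  The graded product is \<open>graded_times\<close> below.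
\<close>

instantiation tensor :: (complex_algebra, complex_algebra) complex_algebra
begin
definition times_tensor :: "('a, 'b) tensor \<Rightarrow> ('a, 'b) tensor \<Rightarrow> ('a, 'b) tensor"
  where "times_tensor = tensor_map2 (*) (*)"
definition one_tensor :: "('a, 'b) tensor"
  where "one_tensor = 1 \<otimes>\<^sub>C 1"

lemma tens_times_tens: "(a \<otimes>\<^sub>C b) * (c \<otimes>\<^sub>C d) = (a * c) \<otimes>\<^sub>C (b * d :: 'b)" for a :: 'a
  unfolding times_tensor_def by (rule tensor_map2_tens) (rule cbilinear_times)+

instance
proof
  have bil: "cbilinear ((*) :: ('a, 'b) tensor \<Rightarrow> _ \<Rightarrow> _)"
    unfolding times_tensor_def by (rule cbilinear_tensor_map2) (rule cbilinear_times)+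
  fix r s t :: "('a, 'b) tensor" and c :: complex
  show l: "(r + s) * t = r * t + s * t" for r s t :: "('a, 'b) tensor"
    using bil by (simp add: cbilinear_def clinear_iff)
  show r: "r * (s + t) = r * s + r * t" for r s t :: "('a, 'b) tensor"
    using bil by (simp add: cbilinear_def clinear_iff)
  show "(c *\<^sub>C s) * t = c *\<^sub>C (s * t)"
    using bil by (simp add: cbilinear_def clinear_iff)
  show "s * (c *\<^sub>C t) = c *\<^sub>C (s * t)"
    using bil by (simp add: cbilinear_def clinear_iff)
  show "1 * t = t"
    by (induct t rule: tensor_induct) (simp_all add: one_tensor_def tens_times_tens r)
  show "t * 1 = t"
    by (induct t rule: tensor_induct) (simp_all add: one_tensor_def tens_times_tens l)
  show "(r * s) * t = r * (s * t)"
  proof (induct r rule: tensor_induct)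
    case (tens a b)
    show ?case
    proof (induct s rule: tensor_induct)
      case (tens a' b')
      show ?case
        by (induct t rule: tensor_induct) (simp_all add: tens_times_tens r mult.assoc)
    qed (simp add: l r)
  qed (simp add: l)
qed
end

definition ctrilinear :: "('a::complex_vector \<Rightarrow> 'b::complex_vector \<Rightarrow> 'c::complex_vector \<Rightarrow> 'd::complex_vector) \<Rightarrow> bool"
  where "ctrilinear \<beta> \<longleftrightarrow> (\<forall>a. cbilinear (\<beta> a)) \<and> (\<forall>b c. clinear (\<lambda>a. \<beta> a b c))"

lemma clinear_add: "clinear f \<Longrightarrow> f (x + y) = f x + f y"
  and clinear_scaleC: "clinear f \<Longrightarrow> f (c *\<^sub>C x) = c *\<^sub>C f x"
  by (simp_all add: clinear_iff)

lemma clinear_comp: "clinear f \<Longrightarrow> clinear g \<Longrightarrow> clinear (\<lambda>x. f (g x))"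
  by (simp add: clinear_iff)

lemma clinear_eq_tensor:
  assumes "clinear f" "clinear g" "\<And>a b. f (a \<otimes>\<^sub>C b) = g (a \<otimes>\<^sub>C b)"
  shows "f t = g t"
  by (induct t rule: tensor_induct) (simp_all add: assms clinear_add)

lemma tensor_lift_compose:
  assumes "clinear f" "cbilinear \<beta>"
  shows "f (tensor_lift \<beta> t) = tensor_lift (\<lambda>a b. f (\<beta> a b)) t"
proof (rule clinear_eq_tensor[of "\<lambda>t. f (tensor_lift \<beta> t)"])
  have b: "cbilinear (\<lambda>a b. f (\<beta> a b))"
    using assms by (simp add: cbilinear_def clinear_iff)
  show "clinear (\<lambda>t. f (tensor_lift \<beta> t))"
    by (rule clinear_comp[OF assms(1) clinear_tensor_lift[OF assms(2)]])
  show "clinear (tensor_lift (\<lambda>a b. f (\<beta> a b)))"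
    by (rule clinear_tensor_lift[OF b])
  show "f (tensor_lift \<beta> (a \<otimes>\<^sub>C b)) = tensor_lift (\<lambda>a b. f (\<beta> a b)) (a \<otimes>\<^sub>C b)" for a b
    by (simp add: tensor_lift_tens assms b)
qed

lemma cbilinear_map: "clinear f \<Longrightarrow> clinear g \<Longrightarrow> cbilinear (\<lambda>a b. f a \<otimes>\<^sub>C g b)"
  by (simp add: cbilinear_def clinear_iff tens_add_left tens_add_right tens_scale_left tens_scale_right)

lemma tensor_map_tens: "clinear f \<Longrightarrow> clinear g \<Longrightarrow> tensor_map f g (a \<otimes>\<^sub>C b) = f a \<otimes>\<^sub>C g b"
  by (simp add: tensor_map_def tensor_lift_tens cbilinear_map)

lemma clinear_tensor_map: "clinear f \<Longrightarrow> clinear g \<Longrightarrow> clinear (tensor_map f g)"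
  by (simp add: tensor_map_def clinear_tensor_lift cbilinear_map)

lemma clinear_id: "clinear id"
  by (simp add: clinear_iff)

lemma cbilinear_tri:
  assumes "ctrilinear \<beta>"
  shows "cbilinear (\<lambda>a. tensor_lift (\<beta> a))" "cbilinear (\<lambda>u c. tensor_lift (\<lambda>a b. \<beta> a b c) u)"
proof -
  have b: "cbilinear (\<beta> a)" "cbilinear (\<lambda>a b. \<beta> a b c)" for a c
    using assms by (simp_all add: ctrilinear_def cbilinear_def)
  note l = clinear_tensor_lift[OF b(1)] clinear_tensor_lift[OF b(2)]
  have "clinear (\<lambda>a. tensor_lift (\<beta> a) u)" for u
  proof (induct u rule: tensor_induct)
    case (tens b c) then show ?case using assms by (simp add: tensor_lift_tens b(1) ctrilinear_def)
  next
    case (add s t) then show ?case by (simp add: clinear_iff clinear_add[OF l(1)] scaleC_add_right)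
  qed
  then show "cbilinear (\<lambda>a. tensor_lift (\<beta> a))" using l by (simp add: cbilinear_def)
  have "clinear (\<lambda>c. tensor_lift (\<lambda>a b. \<beta> a b c) u)" for u
  proof (induct u rule: tensor_induct)
    case (tens b c) then show ?case using assms by (simp add: tensor_lift_tens b(2) ctrilinear_def cbilinear_def)
  next
    case (add s t) then show ?case by (simp add: clinear_iff clinear_add[OF l(2)] scaleC_add_right)
  qed
  then show "cbilinear (\<lambda>u c. tensor_lift (\<lambda>a b. \<beta> a b c) u)" using l by (simp add: cbilinear_def)
qed

lemma cbilinear_precomp: "cbilinear \<beta> \<Longrightarrow> clinear f \<Longrightarrow> clinear g \<Longrightarrow> cbilinear (\<lambda>a b. \<beta> (f a) (g b))"
  by (simp add: cbilinear_def clinear_iff)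

lemma lift_map:
  assumes "cbilinear \<beta>" "clinear f" "clinear g"
  shows "tensor_lift \<beta> (tensor_map f g t) = tensor_lift (\<lambda>a b. \<beta> (f a) (g b)) t"
  unfolding tensor_map_def
  by (subst tensor_lift_compose) (simp_all add: clinear_tensor_lift assms cbilinear_map tensor_lift_tens)

lemma lift_assoc:
  assumes "ctrilinear \<beta>"
  shows "tensor_lift (\<lambda>a. tensor_lift (\<beta> a)) (tensor_assoc s)
    = tensor_lift (\<lambda>u c. tensor_lift (\<lambda>a b. \<beta> a b c) u) s"
proof -
  have t3: "ctrilinear (\<lambda>a b c. a \<otimes>\<^sub>C (b \<otimes>\<^sub>C c))"
    by (simp add: ctrilinear_def cbilinear_def clinear_iff tens_add_left tens_add_right tens_scale_left tens_scale_right)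
  have b: "cbilinear (\<beta> a)" "cbilinear (\<lambda>a b. \<beta> a b c)" for a c
    using assms by (simp_all add: ctrilinear_def cbilinear_def)
  have b3: "cbilinear (\<lambda>a b. a \<otimes>\<^sub>C (b \<otimes>\<^sub>C c))" for c
    by (simp add: cbilinear_def clinear_iff tens_add_left tens_add_right tens_scale_left tens_scale_right)
  note l = clinear_tensor_lift[OF cbilinear_tri(1)[OF assms]]
  show ?thesis
    unfolding tensor_assoc_def
    apply (subst tensor_lift_compose[OF l cbilinear_tri(2)[OF t3]])
    apply (subst tensor_lift_compose[OF l b3])
    apply (simp add: tensor_lift_tens cbilinear_tri(1)[OF assms] b)
    done
qed

section \<open>\<open>*\<close>-algebras and C*-algebras\<close>

definition star_algebra :: "('a::complex_algebra \<Rightarrow> 'a) \<Rightarrow> bool"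
  where "star_algebra st \<longleftrightarrow>
    antilinear st \<and> (\<forall>x. st (st x) = x) \<and> (\<forall>x y. st (x * y) = st y * st x)"

definition star_subalgebra :: "('a::complex_algebra \<Rightarrow> 'a) \<Rightarrow> 'a set \<Rightarrow> bool"
  where "star_subalgebra st B \<longleftrightarrow>
    csubspace B \<and> 1 \<in> B \<and> (\<forall>x\<in>B. \<forall>y\<in>B. x * y \<in> B) \<and> (\<forall>x\<in>B. st x \<in> B)"

definition star_hom :: "('a::complex_algebra \<Rightarrow> 'a) \<Rightarrow> ('b::complex_algebra \<Rightarrow> 'b) \<Rightarrow> ('a \<Rightarrow> 'b) \<Rightarrow> bool"
  where "star_hom st st' f \<longleftrightarrow>
    clinear f \<and> f 1 = 1 \<and> (\<forall>x y. f (x * y) = f x * f y) \<and> (\<forall>x. f (st x) = st' (f x))"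

definition cstar_norm_on :: "'a::complex_algebra set \<Rightarrow> ('a \<Rightarrow> 'a) \<Rightarrow> ('a \<Rightarrow> real) \<Rightarrow> bool"
  where "cstar_norm_on B st N \<longleftrightarrow>
    (\<forall>x\<in>B. 0 \<le> N x \<and> (N x = 0 \<longleftrightarrow> x = 0)) \<and>
    (\<forall>x\<in>B. \<forall>y\<in>B. N (x + y) \<le> N x + N y) \<and>
    (\<forall>c. \<forall>x\<in>B. N (c *\<^sub>C x) = cmod c * N x) \<and>
    (\<forall>x\<in>B. \<forall>y\<in>B. N (x * y) \<le> N x * N y) \<and>
    (\<forall>x\<in>B. N (st x * x) = (N x)\<^sup>2)"

definition complete_norm :: "('a::ab_group_add \<Rightarrow> real) \<Rightarrow> bool"
  where "complete_norm N \<longleftrightarrow> (\<forall>X :: nat \<Rightarrow> 'a.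
    (\<forall>e>0. \<exists>M. \<forall>m\<ge>M. \<forall>n\<ge>M. N (X m - X n) < e) \<longrightarrow> (\<exists>l. (\<lambda>n. N (X n - l)) \<longlonglongrightarrow> 0))"

definition cstar_algebra :: "('a::complex_algebra \<Rightarrow> 'a) \<Rightarrow> ('a \<Rightarrow> real) \<Rightarrow> bool"
  where "cstar_algebra st N \<longleftrightarrow> star_algebra st \<and> cstar_norm_on UNIV st N \<and> complete_norm N"

definition dense_map :: "('b::ab_group_add \<Rightarrow> real) \<Rightarrow> ('a \<Rightarrow> 'b) \<Rightarrow> bool"
  where "dense_map N f \<longleftrightarrow> (\<forall>y. \<forall>e>0. \<exists>x. N (y - f x) < e)"

section \<open>Compact matrix quantum groups\<close>

record (overloaded) 'h hopf =
  comult :: "'h \<Rightarrow> ('h::complex_algebra, 'h) tensor"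
  counit :: "'h \<Rightarrow> complex"
  antipode :: "'h \<Rightarrow> 'h"
  hopf_star :: "'h \<Rightarrow> 'h"

definition hopf_star_algebra :: "'h::complex_algebra hopf \<Rightarrow> bool"
  where "hopf_star_algebra H \<longleftrightarrow>
    star_algebra (hopf_star H) \<and>
    star_hom (hopf_star H) (tensor_antimap (hopf_star H) (hopf_star H)) (comult H) \<and>
    star_hom (hopf_star H) cnj (counit H) \<and>
    clinear (antipode H) \<and>
    (\<forall>h. tensor_assoc (tensor_map (comult H) id (comult H h))
        = tensor_map id (comult H) (comult H h)) \<and>
    (\<forall>h. tensor_lift (\<lambda>a b. counit H a *\<^sub>C b) (comult H h) = h) \<and>
    (\<forall>h. tensor_lift (\<lambda>a b. counit H b *\<^sub>C a) (comult H h) = h) \<and>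
    (\<forall>h. tensor_lift (\<lambda>a b. antipode H a * b) (comult H h) = counit H h *\<^sub>C 1) \<and>
    (\<forall>h. tensor_lift (\<lambda>a b. a * antipode H b) (comult H h) = counit H h *\<^sub>C 1)"

lemma lift_coassoc:
  assumes H: "hopf_star_algebra H" and "ctrilinear \<beta>"
  shows "tensor_lift (\<lambda>a x. tensor_lift (\<beta> a) (comult H x)) (comult H g)
    = tensor_lift (\<lambda>x c. tensor_lift (\<lambda>a b. \<beta> a b c) (comult H x)) (comult H g)"
proof -
  have \<Delta>: "clinear (comult H)"
    using H by (simp add: hopf_star_algebra_def star_hom_def)
  have "tensor_lift (\<lambda>a x. tensor_lift (\<beta> a) (comult H x)) (comult H g)
      = tensor_lift (\<lambda>a. tensor_lift (\<beta> a)) (tensor_map id (comult H) (comult H g))"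
    by (subst lift_map[OF cbilinear_tri(1)[OF assms(2)] clinear_id \<Delta>]) simp
  also have "tensor_map id (comult H) (comult H g) = tensor_assoc (tensor_map (comult H) id (comult H g))"
    using H by (simp add: hopf_star_algebra_def)
  also have "tensor_lift (\<lambda>a. tensor_lift (\<beta> a)) \<dots> = tensor_lift (\<lambda>u c. tensor_lift (\<lambda>a b. \<beta> a b c) u) (tensor_map (comult H) id (comult H g))"
    by (rule lift_assoc[OF assms(2)])
  also have "\<dots> = tensor_lift (\<lambda>x c. tensor_lift (\<lambda>a b. \<beta> a b c) (comult H x)) (comult H g)"
    by (subst lift_map[OF cbilinear_tri(2)[OF assms(2)] \<Delta> clinear_id]) simp
  finally show ?thesis .
qed

text \<open>
  A compact matrix quantum group in the sense of Woronowicz: a unital C*-algebra on the type \<open>'a\<close>,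
  an \<open>n \<times> n\<close> matrix \<open>u\<close>, the minimal C*-tensor square \<open>'c\<close> of \<open>'a\<close> with the canonical map
  \<open>min_incl\<close> from the algebraic tensor square, and the comultiplication into it.  The dense
  \<open>*\<close>-subalgebra generated by the entries of \<open>u\<close> is the image of the Hopf \<open>*\<close>-algebra \<open>'h\<close>
  under the injection \<open>dense_incl\<close>, and \<open>u\<close> is given as a matrix over \<open>'h\<close>.
\<close>

record (overloaded) ('a, 'c, 'h) cmqg =
  alg_star :: "'a::complex_algebra \<Rightarrow> 'a"
  alg_norm :: "'a \<Rightarrow> real"
  min_star :: "'c::complex_algebra \<Rightarrow> 'c"
  min_norm :: "'c \<Rightarrow> real"
  min_incl :: "('a, 'a) tensor \<Rightarrow> 'c"
  alg_comult :: "'a \<Rightarrow> 'c"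
  dense_hopf :: "'h::complex_algebra hopf"
  dense_incl :: "'h \<Rightarrow> 'a"
  mat_size :: nat
  mat :: "nat \<Rightarrow> nat \<Rightarrow> 'h"

text \<open>The minimal (spatial) C*-norm is the least C*-norm on the algebraic tensor product.\<close>

definition minimal_cstar_tensor_square :: "('a::complex_algebra, 'c::complex_algebra, 'h::complex_algebra) cmqg \<Rightarrow> bool"
  where "minimal_cstar_tensor_square G \<longleftrightarrow>
    (let st = tensor_antimap (alg_star G) (alg_star G); N = (\<lambda>t. min_norm G (min_incl G t)) in
      cstar_algebra (min_star G) (min_norm G) \<and>
      star_hom st (min_star G) (min_incl G) \<and>
      dense_map (min_norm G) (min_incl G) \<and>
      cstar_norm_on UNIV st N \<and>
      (\<forall>N'. cstar_norm_on UNIV st N' \<longrightarrow> (\<forall>t. N t \<le> N' t)))"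

definition compact_matrix_quantum_group ::
    "('a::complex_algebra, 'c::complex_algebra, 'h::complex_algebra) cmqg \<Rightarrow> bool"
  where "compact_matrix_quantum_group G \<longleftrightarrow>
    (let H = dense_hopf G; n = mat_size G; u = mat G in
      cstar_algebra (alg_star G) (alg_norm G) \<and>
      minimal_cstar_tensor_square G \<and>
      star_hom (alg_star G) (min_star G) (alg_comult G) \<and>
      hopf_star_algebra H \<and>
      star_hom (hopf_star H) (alg_star G) (dense_incl G) \<and>
      inj (dense_incl G) \<and>
      dense_map (alg_norm G) (dense_incl G) \<and>
      (\<forall>h. alg_comult G (dense_incl G h)
          = min_incl G (tensor_map (dense_incl G) (dense_incl G) (comult H h))) \<and>
      n \<ge> 1 \<and>
      (\<forall>X. star_subalgebra (hopf_star H) X \<and> (\<forall>k<n. \<forall>l<n. u k l \<in> X) \<longrightarrow> X = UNIV) \<and>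
      (\<forall>k<n. \<forall>l<n. comult H (u k l) = (\<Sum>r<n. u k r \<otimes>\<^sub>C u r l)) \<and>
      (\<forall>k<n. \<forall>l<n. counit H (u k l) = (if k = l then 1 else 0)) \<and>
      (\<forall>k<n. \<forall>l<n. (\<Sum>r<n. antipode H (u k r) * u r l) = (if k = l then 1 else 0)) \<and>
      (\<forall>k<n. \<forall>l<n. (\<Sum>r<n. u k r * antipode H (u r l)) = (if k = l then 1 else 0)) \<and>
      (\<forall>g h. antipode H (g * h) = antipode H h * antipode H g) \<and>
      (\<forall>h. antipode H (hopf_star H (antipode H (hopf_star H h))) = h))"

definition corepresentation ::
    "'h::complex_algebra hopf \<Rightarrow> ('v::complex_vector \<Rightarrow> ('v, 'h) tensor) \<Rightarrow> bool"
  where "corepresentation H \<delta> \<longleftrightarrow>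
    clinear \<delta> \<and>
    (\<forall>v. tensor_lift (\<lambda>w h. counit H h *\<^sub>C w) (\<delta> v) = v) \<and>
    (\<forall>v. tensor_map id (comult H) (\<delta> v) = tensor_assoc (tensor_map \<delta> id (\<delta> v)))"

section \<open>Quantum principal bundles\<close>

record (overloaded) ('p, 'h) qpb =
  total_star :: "'p::complex_algebra \<Rightarrow> 'p"
  base :: "'p set"
  coaction :: "'p \<Rightarrow> ('p, 'h::complex_algebra) tensor"

definition quantum_principal_bundle ::
    "'h::complex_algebra hopf \<Rightarrow> ('p::complex_algebra, 'h) qpb \<Rightarrow> bool"
  where "quantum_principal_bundle H \<zeta> \<longleftrightarrow>
    star_algebra (total_star \<zeta>) \<and>
    star_subalgebra (total_star \<zeta>) (base \<zeta>) \<and>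
    star_hom (total_star \<zeta>) (tensor_antimap (total_star \<zeta>) (hopf_star H)) (coaction \<zeta>) \<and>
    corepresentation H (coaction \<zeta>) \<and>
    (\<forall>x. coaction \<zeta> x = x \<otimes>\<^sub>C 1 \<longleftrightarrow> x \<in> base \<zeta>) \<and>
    surj (tensor_lift (\<lambda>x y. (x \<otimes>\<^sub>C 1) * coaction \<zeta> y)) \<and>
    (\<exists>N. cstar_norm_on (base \<zeta>) (total_star \<zeta>) N)"

section \<open>First-order calculi\<close>

record (overloaded) ('h, 'g) fodc =
  lact :: "'h::complex_algebra \<Rightarrow> 'g::complex_vector \<Rightarrow> 'g"
  ract :: "'g \<Rightarrow> 'h \<Rightarrow> 'g"
  fod :: "'h \<Rightarrow> 'g"
  fod_star :: "'g \<Rightarrow> 'g"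
  lcoact :: "'g \<Rightarrow> ('h, 'g) tensor"
  rcoact :: "'g \<Rightarrow> ('g, 'h) tensor"

definition bimodule :: "('h::complex_algebra, 'g::complex_vector) fodc \<Rightarrow> bool"
  where "bimodule \<Gamma> \<longleftrightarrow>
    cbilinear (lact \<Gamma>) \<and> cbilinear (ract \<Gamma>) \<and>
    (\<forall>\<gamma>. lact \<Gamma> 1 \<gamma> = \<gamma> \<and> ract \<Gamma> \<gamma> 1 = \<gamma>) \<and>
    (\<forall>g h \<gamma>. lact \<Gamma> (g * h) \<gamma> = lact \<Gamma> g (lact \<Gamma> h \<gamma>)) \<and>
    (\<forall>g h \<gamma>. ract \<Gamma> \<gamma> (g * h) = ract \<Gamma> (ract \<Gamma> \<gamma> g) h) \<and>
    (\<forall>g h \<gamma>. ract \<Gamma> (lact \<Gamma> g \<gamma>) h = lact \<Gamma> g (ract \<Gamma> \<gamma> h))"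

text \<open>
  The last two clauses are bicovariance: they say that \<open>g dh \<mapsto> \<Delta>(g) (id \<otimes> d)\<Delta>(h)\<close> and
  \<open>g dh \<mapsto> \<Delta>(g) (d \<otimes> id)\<Delta>(h)\<close> are well-defined linear maps on the whole of \<open>\<Gamma>\<close>, which
  determines the two coactions because \<open>\<Gamma>\<close> is spanned by the elements \<open>g dh\<close>.
\<close>

definition bicovariant_star_calculus ::
    "'h::complex_algebra hopf \<Rightarrow> ('h, 'g::complex_vector) fodc \<Rightarrow> bool"
  where "bicovariant_star_calculus H \<Gamma> \<longleftrightarrow>
    bimodule \<Gamma> \<and>
    clinear (fod \<Gamma>) \<and>
    (\<forall>g h. fod \<Gamma> (g * h) = ract \<Gamma> (fod \<Gamma> g) h + lact \<Gamma> g (fod \<Gamma> h)) \<and>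
    cspan {lact \<Gamma> g (fod \<Gamma> h) | g h. True} = UNIV \<and>
    antilinear (fod_star \<Gamma>) \<and>
    (\<forall>\<gamma>. fod_star \<Gamma> (fod_star \<Gamma> \<gamma>) = \<gamma>) \<and>
    (\<forall>h \<gamma>. fod_star \<Gamma> (lact \<Gamma> h \<gamma>) = ract \<Gamma> (fod_star \<Gamma> \<gamma>) (hopf_star H h)) \<and>
    (\<forall>h. fod_star \<Gamma> (fod \<Gamma> h) = fod \<Gamma> (hopf_star H h)) \<and>
    clinear (lcoact \<Gamma>) \<and>
    clinear (rcoact \<Gamma>) \<and>
    (\<forall>g h. lcoact \<Gamma> (lact \<Gamma> g (fod \<Gamma> h))
        = tensor_map2 (*) (lact \<Gamma>) (comult H g) (tensor_map id (fod \<Gamma>) (comult H h))) \<and>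
    (\<forall>g h. rcoact \<Gamma> (lact \<Gamma> g (fod \<Gamma> h))
        = tensor_map2 (lact \<Gamma>) (*) (comult H g) (tensor_map (fod \<Gamma>) id (comult H h)))"

definition left_invariant :: "('h::complex_algebra, 'g::complex_vector) fodc \<Rightarrow> 'g set"
  where "left_invariant \<Gamma> = {\<gamma>. lcoact \<Gamma> \<gamma> = 1 \<otimes>\<^sub>C \<gamma>}"

lemma left_invariant_germ:
  fixes H :: "'h::complex_algebra hopf" and \<Gamma> :: "('h, 'g::complex_vector) fodc"
  assumes H: "hopf_star_algebra H" and \<Gamma>: "bicovariant_star_calculus H \<Gamma>"
  shows "tensor_lift (\<lambda>a b. lact \<Gamma> (antipode H a) (fod \<Gamma> b)) (comult H g) \<in> left_invariant \<Gamma>"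
proof -
  let ?\<Delta> = "comult H" and ?S = "antipode H" and ?d = "fod \<Gamma>" and ?\<epsilon> = "counit H"
  let ?m = "tensor_map2 ((*) :: 'h \<Rightarrow> 'h \<Rightarrow> 'h) (lact \<Gamma>)"
  have l: "clinear ?\<Delta>" "clinear ?S" "clinear ?d" "clinear (lcoact \<Gamma>)" "clinear ?\<epsilon>"
    using H \<Gamma> by (simp_all add: hopf_star_algebra_def star_hom_def bicovariant_star_calculus_def)
  have la: "cbilinear (lact \<Gamma>)" and la1: "lact \<Gamma> 1 \<gamma> = \<gamma>" and laa: "lact \<Gamma> (x * y) \<gamma> = lact \<Gamma> x (lact \<Gamma> y \<gamma>)" for \<gamma> x y
    using \<Gamma> by (simp_all add: bicovariant_star_calculus_def bimodule_def)
  have dm: "?\<Delta> (x * y) = ?\<Delta> x * ?\<Delta> y" "?\<Delta> 1 = 1 \<otimes>\<^sub>C 1" for x y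
    using H by (simp_all add: hopf_star_algebra_def star_hom_def one_tensor_def)
  have cu: "tensor_lift (\<lambda>a b. ?\<epsilon> a *\<^sub>C b) (?\<Delta> h) = h" 
    and an: "tensor_lift (\<lambda>a b. ?S a * b) (?\<Delta> h) = ?\<epsilon> h *\<^sub>C 1" "tensor_lift (\<lambda>a b. a * ?S b) (?\<Delta> h) = ?\<epsilon> h *\<^sub>C 1" for h
    using H by (simp_all add: hopf_star_algebra_def)
  have m: "cbilinear ?m"
    by (rule cbilinear_tensor_map2[OF cbilinear_times la])
  have mt: "?m (a \<otimes>\<^sub>C b) (c \<otimes>\<^sub>C e) = (a * c) \<otimes>\<^sub>C lact \<Gamma> b e" for a b c e
    by (rule tensor_map2_tens[OF cbilinear_times la])
  have ml: "clinear (?m s)" "clinear (\<lambda>s. ?m s t)" for s t using m by (simp_all add: cbilinear_def)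
  have m1: "?m (1 \<otimes>\<^sub>C 1) t = t" for t
    by (rule clinear_eq_tensor[OF ml(1) clinear_id[unfolded id_def]]) (simp add: mt la1)
  have ma: "?m (s * s') t = ?m s (?m s' t)" for s s' t
  proof (induct s rule: tensor_induct)
    case (tens a b) show ?case
    proof (induct s' rule: tensor_induct)
      case (tens a' b')
      show ?case
        by (induct t rule: tensor_induct) (simp_all add: mt tens_times_tens clinear_add[OF ml(1)] mult.assoc laa)
    qed (simp add: distrib_left clinear_add[OF ml(1)] clinear_add[OF ml(2)])
  qed (simp add: distrib_right clinear_add[OF ml(2)])
  have cl: "\<And>f x y. clinear f \<Longrightarrow> f (x+y) = f x + f y" "\<And>f c x. clinear f \<Longrightarrow> f (c *\<^sub>C x) = c *\<^sub>C f x"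
    by (simp_all add: clinear_iff)
  have bl: "lact \<Gamma> (x+y) \<gamma> = lact \<Gamma> x \<gamma> + lact \<Gamma> y \<gamma>" "lact \<Gamma> (c *\<^sub>C x) \<gamma> = c *\<^sub>C lact \<Gamma> x \<gamma>"
    "lact \<Gamma> x (\<gamma>+\<gamma>') = lact \<Gamma> x \<gamma> + lact \<Gamma> x \<gamma>'" "lact \<Gamma> x (c *\<^sub>C \<gamma>) = c *\<^sub>C lact \<Gamma> x \<gamma>" for x y c \<gamma> \<gamma>'
    using la by (simp_all add: cbilinear_def clinear_iff)
  note lin = l[THEN cl(1)] l[THEN cl(2)] bl ml[THEN cl(1)] ml[THEN cl(2)]
    tens_add_left tens_add_right tens_scale_left tens_scale_right algebra_simps scaleC_mult_left scaleC_mult_right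
    scaleC_add_right scaleC_add_left
  define p where "p g = tensor_lift (\<lambda>a b. lact \<Gamma> (?S a) (?d b)) (?\<Delta> g)" for g
  have pb: "cbilinear (\<lambda>a b. lact \<Gamma> (?S a) (?d b))"
    by (simp add: cbilinear_def clinear_iff lin)
  have pl: "clinear p" unfolding p_def by (rule clinear_comp[OF clinear_tensor_lift[OF pb] l(1)])
  note lin = lin pl[THEN cl(1)] pl[THEN cl(2)]
  have c0: "tensor_lift (\<lambda>a x. lact \<Gamma> a (p x)) (?\<Delta> h) = ?d h" for h
  proof -
    have lb: "clinear (lact \<Gamma> a)" "clinear (\<lambda>a. lact \<Gamma> a \<gamma>)" for a \<gamma> using la by (simp_all add: cbilinear_def)
    have "tensor_lift (\<lambda>a x. lact \<Gamma> a (p x)) (?\<Delta> h)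
      = tensor_lift (\<lambda>a x. tensor_lift (\<lambda>c e. lact \<Gamma> (a * ?S c) (?d e)) (?\<Delta> x)) (?\<Delta> h)"
      unfolding p_def tensor_lift_compose[OF lb(1) pb] laa ..
    also have "\<dots> = tensor_lift (\<lambda>x e. tensor_lift (\<lambda>a c. lact \<Gamma> (a * ?S c) (?d e)) (?\<Delta> x)) (?\<Delta> h)"
      by (rule lift_coassoc[OF H]) (simp add: ctrilinear_def cbilinear_def clinear_iff lin)
    also have "\<dots> = tensor_lift (\<lambda>x e. lact \<Gamma> (tensor_lift (\<lambda>a c. a * ?S c) (?\<Delta> x)) (?d e)) (?\<Delta> h)"
      by (subst tensor_lift_compose[OF lb(2)]) (simp_all add: cbilinear_def clinear_iff lin)
    also have "\<dots> = tensor_lift (\<lambda>x e. ?d (?\<epsilon> x *\<^sub>C e)) (?\<Delta> h)"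
      by (simp add: an lin la1)
    also have "\<dots> = ?d (tensor_lift (\<lambda>x e. ?\<epsilon> x *\<^sub>C e) (?\<Delta> h))"
      by (rule tensor_lift_compose[OF l(3), symmetric]) (simp add: cbilinear_def clinear_iff lin scaleC_complex_def cvec.scale_scale mult.commute)
    finally show ?thesis by (simp add: cu)
  qed
  have c1: "tensor_lift (\<lambda>x b. ?m (?\<Delta> x) (1 \<otimes>\<^sub>C p b)) (?\<Delta> g) = tensor_map id ?d (?\<Delta> g)" for g
  proof -
    have e: "?m s (1 \<otimes>\<^sub>C \<gamma>) = tensor_lift (\<lambda>a c. a \<otimes>\<^sub>C lact \<Gamma> c \<gamma>) s" for s \<gamma>
    proof -
      have b: "cbilinear (\<lambda>a c. a \<otimes>\<^sub>C lact \<Gamma> c \<gamma>)" by (simp add: cbilinear_def clinear_iff lin)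
      show ?thesis
        by (rule clinear_eq_tensor[OF ml(2) clinear_tensor_lift[OF b]]) (simp add: mt tensor_lift_tens[OF b])
    qed
    have "tensor_lift (\<lambda>x b. ?m (?\<Delta> x) (1 \<otimes>\<^sub>C p b)) (?\<Delta> g)
      = tensor_lift (\<lambda>x b. tensor_lift (\<lambda>a c. a \<otimes>\<^sub>C lact \<Gamma> c (p b)) (?\<Delta> x)) (?\<Delta> g)"
      unfolding e ..
    also have "\<dots> = tensor_lift (\<lambda>a x. tensor_lift (\<lambda>c b. a \<otimes>\<^sub>C lact \<Gamma> c (p b)) (?\<Delta> x)) (?\<Delta> g)"
      by (rule lift_coassoc[OF H, symmetric]) (simp add: ctrilinear_def cbilinear_def clinear_iff lin)
    also have "\<dots> = tensor_lift (\<lambda>a x. a \<otimes>\<^sub>C tensor_lift (\<lambda>c b. lact \<Gamma> c (p b)) (?\<Delta> x)) (?\<Delta> g)"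
      by (subst tensor_lift_compose) (simp_all add: cbilinear_def clinear_iff lin)
    finally show ?thesis by (simp add: c0 tensor_map_def)
  qed
  have bb: "cbilinear (\<lambda>x b. ?m (?\<Delta> x) (1 \<otimes>\<^sub>C p b))"
    by (simp add: cbilinear_def clinear_iff lin)
  have "lcoact \<Gamma> (p g) = tensor_lift (\<lambda>a b. lcoact \<Gamma> (lact \<Gamma> (?S a) (?d b))) (?\<Delta> g)"
    unfolding p_def by (rule tensor_lift_compose[OF l(4) pb])
  also have "\<dots> = tensor_lift (\<lambda>a x. ?m (?\<Delta> (?S a)) (tensor_map id ?d (?\<Delta> x))) (?\<Delta> g)"
    using \<Gamma> by (simp add: bicovariant_star_calculus_def)
  also have "\<dots> = tensor_lift (\<lambda>a x. tensor_lift (\<lambda>c b. ?m (?\<Delta> (?S a * c)) (1 \<otimes>\<^sub>C p b)) (?\<Delta> x)) (?\<Delta> g)"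
    unfolding c1[symmetric] tensor_lift_compose[OF ml(1) bb] dm ma ..
  also have "\<dots> = tensor_lift (\<lambda>x b. tensor_lift (\<lambda>a c. ?m (?\<Delta> (?S a * c)) (1 \<otimes>\<^sub>C p b)) (?\<Delta> x)) (?\<Delta> g)"
    by (rule lift_coassoc[OF H]) (simp add: ctrilinear_def cbilinear_def clinear_iff lin)
  also have "\<dots> = tensor_lift (\<lambda>x b. ?m (?\<Delta> (tensor_lift (\<lambda>a c. ?S a * c) (?\<Delta> x))) (1 \<otimes>\<^sub>C p b)) (?\<Delta> g)"
    by (subst tensor_lift_compose[OF clinear_comp[OF ml(2) l(1)]]) (simp_all add: cbilinear_def clinear_iff lin)
  also have "\<dots> = tensor_lift (\<lambda>x b. 1 \<otimes>\<^sub>C p (?\<epsilon> x *\<^sub>C b)) (?\<Delta> g)"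
    by (simp add: an lin dm m1)
  also have "\<dots> = 1 \<otimes>\<^sub>C p (tensor_lift (\<lambda>x b. ?\<epsilon> x *\<^sub>C b) (?\<Delta> g))"
    by (subst tensor_lift_compose[of "\<lambda>h. 1 \<otimes>\<^sub>C p h"]) (simp_all add: cbilinear_def clinear_iff lin scaleC_complex_def cvec.scale_scale mult.commute)
  finally show ?thesis by (simp add: cu left_invariant_def p_def)
qed

section \<open>Graded differential \<open>*\<close>-algebras\<close>

definition homogeneous_parts ::
    "(nat \<Rightarrow> 'o::complex_vector set) \<Rightarrow> 'o \<Rightarrow> (nat \<Rightarrow> 'o) \<Rightarrow> bool"
  where "homogeneous_parts gr x f \<longleftrightarrow>
    (\<forall>k. f k \<in> gr k) \<and> finite {k. f k \<noteq> 0} \<and> x = (\<Sum>k | f k \<noteq> 0. f k)"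

definition grading :: "(nat \<Rightarrow> 'o::complex_vector set) \<Rightarrow> bool"
  where "grading gr \<longleftrightarrow> (\<forall>k. csubspace (gr k)) \<and> (\<forall>x. \<exists>!f. homogeneous_parts gr x f)"

record (overloaded) 'o gda =
  hpart :: "nat \<Rightarrow> 'o::complex_algebra set"
  diff :: "'o \<Rightarrow> 'o"
  gstar :: "'o \<Rightarrow> 'o"

definition component :: "'o::complex_algebra gda \<Rightarrow> nat \<Rightarrow> 'o \<Rightarrow> 'o"
  where "component A k x = (THE f. homogeneous_parts (hpart A) x f) k"

definition degrees :: "'o::complex_algebra gda \<Rightarrow> 'o \<Rightarrow> nat set"
  where "degrees A x = {k. component A k x \<noteq> 0}"

definition graded_diff_star_algebra :: "'o::complex_algebra gda \<Rightarrow> bool"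
  where "graded_diff_star_algebra A \<longleftrightarrow>
    grading (hpart A) \<and>
    1 \<in> hpart A 0 \<and>
    (\<forall>k l. \<forall>x\<in>hpart A k. \<forall>y\<in>hpart A l. x * y \<in> hpart A (k + l)) \<and>
    clinear (diff A) \<and>
    (\<forall>k. \<forall>x\<in>hpart A k. diff A x \<in> hpart A (Suc k)) \<and>
    (\<forall>x. diff A (diff A x) = 0) \<and>
    (\<forall>k. \<forall>x\<in>hpart A k. \<forall>y. diff A (x * y) = diff A x * y + (-1) ^ k *\<^sub>C (x * diff A y)) \<and>
    antilinear (gstar A) \<and>
    (\<forall>x. gstar A (gstar A x) = x) \<and>
    (\<forall>k. \<forall>x\<in>hpart A k. gstar A x \<in> hpart A k) \<and>
    (\<forall>k l. \<forall>x\<in>hpart A k. \<forall>y\<in>hpart A l.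
        gstar A (x * y) = (-1) ^ (k * l) *\<^sub>C (gstar A y * gstar A x)) \<and>
    (\<forall>x. diff A (gstar A x) = gstar A (diff A x))"

definition tensor_hpart :: "'o::complex_algebra gda \<Rightarrow> 'w::complex_algebra gda \<Rightarrow> nat \<Rightarrow> ('o, 'w) tensor set"
  where "tensor_hpart A B n =
    cspan {a \<otimes>\<^sub>C b | a b. \<exists>k l. k + l = n \<and> a \<in> hpart A k \<and> b \<in> hpart B l}"

text \<open>\<open>(a \<otimes> b)(a' \<otimes> b') = (-1)\<^sup>k\<^sup>l aa' \<otimes> bb'\<close> for \<open>b\<close> of degree \<open>k\<close> and \<open>a'\<close> of degree \<open>l\<close>.\<close>

definition graded_times :: "'o::complex_algebra gda \<Rightarrow> 'w::complex_algebra gda \<Rightarrow>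
    ('o, 'w) tensor \<Rightarrow> ('o, 'w) tensor \<Rightarrow> ('o, 'w) tensor"
  where "graded_times A B s t =
    tensor_lift (\<lambda>a b. tensor_lift (\<lambda>a' b'.
      \<Sum>k\<in>degrees B b. \<Sum>l\<in>degrees A a'.
        (-1) ^ (k * l) *\<^sub>C ((a * component A l a') \<otimes>\<^sub>C (component B k b * b'))) t) s"

text \<open>\<open>d(a \<otimes> b) = da \<otimes> b + (-1)\<^sup>k a \<otimes> db\<close> for \<open>a\<close> of degree \<open>k\<close>.\<close>

definition tensor_diff :: "'o::complex_algebra gda \<Rightarrow> 'w::complex_algebra gda \<Rightarrow>
    ('o, 'w) tensor \<Rightarrow> ('o, 'w) tensor"
  where "tensor_diff A B = tensor_lift (\<lambda>a b.
    diff A a \<otimes>\<^sub>C b + (\<Sum>k\<in>degrees A a. (-1) ^ k *\<^sub>C (component A k a \<otimes>\<^sub>C diff B b)))"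

text \<open>
  Morphisms of graded differential \<open>*\<close>-algebras from \<open>A\<close> into the graded tensor product of \<open>A\<close>
  and \<open>B\<close>.  On that tensor product \<open>(a \<otimes> b)\<^sup>* = a\<^sup>* \<otimes> b\<^sup>*\<close>: the sign from the convention
  \<open>(wv)\<^sup>* = (-1)\<^sup>k\<^sup>l v\<^sup>* w\<^sup>*\<close>, applied to \<open>(a \<otimes> 1)(1 \<otimes> b)\<close>, cancels the one from reordering
  \<open>(1 \<otimes> b\<^sup>*)(a\<^sup>* \<otimes> 1)\<close>.
\<close>

definition gda_coaction :: "'o::complex_algebra gda \<Rightarrow> 'w::complex_algebra gda \<Rightarrow>
    ('o \<Rightarrow> ('o, 'w) tensor) \<Rightarrow> bool"
  where "gda_coaction A B f \<longleftrightarrow>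
    clinear f \<and>
    f 1 = 1 \<otimes>\<^sub>C 1 \<and>
    (\<forall>x y. f (x * y) = graded_times A B (f x) (f y)) \<and>
    (\<forall>k. \<forall>x\<in>hpart A k. f x \<in> tensor_hpart A B k) \<and>
    (\<forall>x. f (diff A x) = tensor_diff A B (f x)) \<and>
    (\<forall>x. f (gstar A x) = tensor_antimap (gstar A) (gstar B) (f x))"

section \<open>The universal differential envelope\<close>

text \<open>
  For \<open>k \<ge> 1\<close> a formal combination of lists of length \<open>k\<close> over \<open>\<Gamma>\<close> represents an element of the
  \<open>k\<close>-fold tensor power of \<open>\<Gamma>\<close> over \<open>H\<close>, the list \<open>[\<gamma>\<^sub>1, \<dots>, \<gamma>\<^sub>k]\<close> standing for
  \<open>\<gamma>\<^sub>1 \<otimes>\<^sub>H \<dots> \<otimes>\<^sub>H \<gamma>\<^sub>k\<close>; two combinations represent the same element iff they are congruent modulo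
  the span of \<open>tensor_power_relations\<close>.
\<close>

definition tensor_power_relations ::
    "('h::complex_algebra, 'g::complex_vector) fodc \<Rightarrow> ('g list \<Rightarrow>\<^sub>0 complex) set"
  where "tensor_power_relations \<Gamma> =
      {gen (xs @ (\<gamma> + \<gamma>') # ys) - gen (xs @ \<gamma> # ys) - gen (xs @ \<gamma>' # ys) | xs \<gamma> \<gamma>' ys. True}
    \<union> {gen (xs @ (c *\<^sub>C \<gamma>) # ys) - c *\<^sub>C gen (xs @ \<gamma> # ys) | xs c \<gamma> ys. True}
    \<union> {gen (xs @ ract \<Gamma> \<gamma> h # \<gamma>' # ys) - gen (xs @ \<gamma> # lact \<Gamma> h \<gamma>' # ys) | xs \<gamma> h \<gamma>' ys. True}"

text \<open>
  The elements \<open>x (\<Sum>\<^sub>i da\<^sub>i \<otimes>\<^sub>H db\<^sub>i) y\<close> with \<open>\<Sum>\<^sub>i a\<^sub>i db\<^sub>i = 0\<close>, which span the two-sided ideal;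
  \<open>x\<close> is \<open>\<gamma>\<^sub>1 \<otimes>\<^sub>H \<dots> \<otimes>\<^sub>H \<gamma>\<^sub>m h\<close>, or just \<open>h\<close>, and similarly for \<open>y\<close>.
\<close>

definition envelope_ideal ::
    "('h::complex_algebra, 'g::complex_vector) fodc \<Rightarrow> ('g list \<Rightarrow>\<^sub>0 complex) set"
  where "envelope_ideal \<Gamma> =
    {(\<Sum>i<n. gen (xs @ lact \<Gamma> h (fod \<Gamma> (a i)) # ract \<Gamma> (fod \<Gamma> (b i)) h' # ys)) | xs h n a b h' ys.
      (\<Sum>i<(n::nat). lact \<Gamma> (a i) (fod \<Gamma> (b i))) = 0}"

record (overloaded) ('h, 'g, 'w) envelope =
  env :: "'w::complex_algebra gda"
  env0 :: "'h::complex_algebra \<Rightarrow> 'w"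
  env1 :: "'g::complex_vector \<Rightarrow> 'w"

text \<open>
  The quotient of the tensor algebra by the ideal, given up to isomorphism: in degree \<open>0\<close> it is
  \<open>H\<close> (the ideal starts in degree \<open>2\<close>), and in positive degrees the canonical map from the tensor
  algebra is onto with kernel the ideal.
\<close>

definition universal_envelope :: "'h::complex_algebra hopf \<Rightarrow> ('h, 'g::complex_vector) fodc \<Rightarrow>
    ('h, 'g, 'w::complex_algebra) envelope \<Rightarrow> bool"
  where "universal_envelope H \<Gamma> E \<longleftrightarrow>
    (let W = env E; \<iota>\<^sub>0 = env0 E; \<iota>\<^sub>1 = env1 E in
      graded_diff_star_algebra W \<and>
      star_hom (hopf_star H) (gstar W) \<iota>\<^sub>0 \<and>
      inj \<iota>\<^sub>0 \<and>
      range \<iota>\<^sub>0 = hpart W 0 \<and>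
      clinear \<iota>\<^sub>1 \<and>
      (\<forall>h \<gamma>. \<iota>\<^sub>1 (lact \<Gamma> h \<gamma>) = \<iota>\<^sub>0 h * \<iota>\<^sub>1 \<gamma>) \<and>
      (\<forall>h \<gamma>. \<iota>\<^sub>1 (ract \<Gamma> \<gamma> h) = \<iota>\<^sub>1 \<gamma> * \<iota>\<^sub>0 h) \<and>
      (\<forall>\<gamma>. \<iota>\<^sub>1 (fod_star \<Gamma> \<gamma>) = gstar W (\<iota>\<^sub>1 \<gamma>)) \<and>
      (\<forall>h. \<iota>\<^sub>1 (fod \<Gamma> h) = diff W (\<iota>\<^sub>0 h)) \<and>
      (\<forall>k\<ge>1. hpart W k = cspan {prod_list (map \<iota>\<^sub>1 xs) | xs. length xs = k}) \<and>
      {t. [] \<notin> Poly_Mapping.keys t \<and> formal_sum id (\<lambda>xs. prod_list (map \<iota>\<^sub>1 xs)) t = 0}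
        = cspan (tensor_power_relations \<Gamma> \<union> envelope_ideal \<Gamma>))"

section \<open>Differential calculi on quantum principal bundles\<close>

text \<open>
  The space of left-invariant elements is given as a type \<open>'q\<close> of its own, embedded into \<open>\<Gamma>\<close>
  by \<open>inv_incl\<close>.  Likewise \<open>forms0\<close> identifies \<open>P\<close> with the forms of degree \<open>0\<close>.
\<close>

record (overloaded) ('h, 'g, 'q, 'w, 'p, 'o) calculus =
  calc :: "('h::complex_algebra, 'g::complex_vector) fodc"
  inv_incl :: "'q::complex_vector \<Rightarrow> 'g"
  envel :: "('h, 'g, 'w::complex_algebra) envelope"
  forms :: "'o::complex_algebra gda"
  forms0 :: "'p::complex_algebra \<Rightarrow> 'o"
  forms_coact :: "'o \<Rightarrow> ('o, 'w) tensor"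

definition generated_by_degree_0 :: "'o::complex_algebra gda \<Rightarrow> bool"
  where "generated_by_degree_0 A \<longleftrightarrow>
    (\<forall>X. csubspace X \<and> hpart A 0 \<subseteq> X \<and> (\<forall>x\<in>X. \<forall>y\<in>X. x * y \<in> X) \<and> (\<forall>x\<in>X. diff A x \<in> X)
      \<longrightarrow> X = UNIV)"

definition differential_calculus :: "'h::complex_algebra hopf \<Rightarrow> ('p::complex_algebra, 'h) qpb \<Rightarrow>
    ('h, 'g::complex_vector, 'q::complex_vector, 'w::complex_algebra, 'p, 'o::complex_algebra) calculus \<Rightarrow> bool"
  where "differential_calculus H \<zeta> C \<longleftrightarrow>
    bicovariant_star_calculus H (calc C) \<and>
    clinear (inv_incl C) \<and> inj (inv_incl C) \<and> range (inv_incl C) = left_invariant (calc C) \<and>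
    universal_envelope H (calc C) (envel C) \<and>
    graded_diff_star_algebra (forms C) \<and>
    star_hom (total_star \<zeta>) (gstar (forms C)) (forms0 C) \<and>
    inj (forms0 C) \<and>
    range (forms0 C) = hpart (forms C) 0 \<and>
    generated_by_degree_0 (forms C) \<and>
    gda_coaction (forms C) (env (envel C)) (forms_coact C) \<and>
    (\<forall>x. forms_coact C (forms0 C x)
        = tensor_map (forms0 C) (env0 (envel C)) (coaction \<zeta> x))"

text \<open>
  \<open>germ\<close> is \<open>\<pi>(g) = S(g\<^sup>(\<^sup>1\<^sup>)) dg\<^sup>(\<^sup>2\<^sup>)\<close>, an element of the range of \<open>inv_incl\<close> by
  \<open>left_invariant_germ\<close>, and \<open>germ_ideal\<close> is \<open>ker \<pi> \<inter> ker \<epsilon>\<close>.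
\<close>

definition germ :: "'h::complex_algebra hopf \<Rightarrow>
    ('h, 'g::complex_vector, 'q::complex_vector, 'w::complex_algebra, 'p::complex_algebra, 'o::complex_algebra) calculus
    \<Rightarrow> 'h \<Rightarrow> 'q"
  where "germ H C g = inv_into UNIV (inv_incl C)
    (tensor_lift (\<lambda>a b. lact (calc C) (antipode H a) (fod (calc C) b)) (comult H g))"

definition germ_ideal :: "'h::complex_algebra hopf \<Rightarrow>
    ('h, 'g::complex_vector, 'q::complex_vector, 'w::complex_algebra, 'p::complex_algebra, 'o::complex_algebra) calculus
    \<Rightarrow> 'h set"
  where "germ_ideal H C = {g. germ H C g = 0 \<and> counit H g = 0}"

text \<open>
  The adjoint corepresentation \<open>ad(\<pi>(g)) = \<pi>(g\<^sup>(\<^sup>2\<^sup>)) \<otimes> S(g\<^sup>(\<^sup>1\<^sup>)) g\<^sup>(\<^sup>3\<^sup>)\<close> and the right action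
  \<open>\<pi>(h) \<diamond> g = \<pi>(hg - \<epsilon>(h)g)\<close>.  Both are independent of the preimage under the surjection \<open>\<pi>\<close>:
  \<open>ad\<close> is the restriction of the right coaction of \<open>\<Gamma>\<close>, and
  \<open>\<pi>(hg - \<epsilon>(h)g) = S(g\<^sup>(\<^sup>1\<^sup>)) \<pi>(h) g\<^sup>(\<^sup>2\<^sup>)\<close>.
\<close>

definition adj :: "'h::complex_algebra hopf \<Rightarrow>
    ('h, 'g::complex_vector, 'q::complex_vector, 'w::complex_algebra, 'p::complex_algebra, 'o::complex_algebra) calculus
    \<Rightarrow> 'q \<Rightarrow> ('q, 'h) tensor"
  where "adj H C \<theta> =
    tensor_lift (\<lambda>a. tensor_lift (\<lambda>b c. germ H C b \<otimes>\<^sub>C (antipode H a * c)))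
      (tensor_map id (comult H) (comult H (inv_into UNIV (germ H C) \<theta>)))"

definition diamond :: "'h::complex_algebra hopf \<Rightarrow>
    ('h, 'g::complex_vector, 'q::complex_vector, 'w::complex_algebra, 'p::complex_algebra, 'o::complex_algebra) calculus
    \<Rightarrow> 'q \<Rightarrow> 'h \<Rightarrow> 'q"
  where "diamond H C \<theta> g =
    (let h = inv_into UNIV (germ H C) \<theta> in germ H C (h * g - counit H h *\<^sub>C g))"

definition inv_star :: "('h::complex_algebra, 'g::complex_vector, 'q::complex_vector,
    'w::complex_algebra, 'p::complex_algebra, 'o::complex_algebra) calculus \<Rightarrow> 'q \<Rightarrow> 'q"
  where "inv_star C \<theta> = inv_into UNIV (inv_incl C) (fod_star (calc C) (inv_incl C \<theta>))"

definition horizontal :: "('h::complex_algebra, 'g::complex_vector, 'q::complex_vector,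
    'w::complex_algebra, 'p::complex_algebra, 'o::complex_algebra) calculus \<Rightarrow> 'o set"
  where "horizontal C = {\<phi>. forms_coact C \<phi> \<in> range (tensor_map id (env0 (envel C)))}"

definition hor_coact :: "('h::complex_algebra, 'g::complex_vector, 'q::complex_vector,
    'w::complex_algebra, 'p::complex_algebra, 'o::complex_algebra) calculus \<Rightarrow> 'o \<Rightarrow> ('o, 'h) tensor"
  where "hor_coact C \<phi> = inv_into UNIV (tensor_map id (env0 (envel C))) (forms_coact C \<phi>)"

definition base_forms :: "('h::complex_algebra, 'g::complex_vector, 'q::complex_vector,
    'w::complex_algebra, 'p::complex_algebra, 'o::complex_algebra) calculus \<Rightarrow> 'o set"
  where "base_forms C = {\<mu>. forms_coact C \<mu> = \<mu> \<otimes>\<^sub>C 1}"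

section \<open>Quantum principal connections\<close>

definition qpc :: "'h::complex_algebra hopf \<Rightarrow>
    ('h, 'g::complex_vector, 'q::complex_vector, 'w::complex_algebra, 'p::complex_algebra, 'o::complex_algebra) calculus
    \<Rightarrow> ('q \<Rightarrow> 'o) set"
  where "qpc H C = {\<omega>.
    clinear \<omega> \<and>
    (\<forall>\<theta>. \<omega> \<theta> \<in> hpart (forms C) 1) \<and>
    (\<forall>\<theta>. forms_coact C (\<omega> \<theta>) =
        tensor_map id (env0 (envel C)) (tensor_map \<omega> id (adj H C \<theta>))
        + 1 \<otimes>\<^sub>C env1 (envel C) (inv_incl C \<theta>))}"

definition real_qpc :: "('h::complex_algebra, 'g::complex_vector, 'q::complex_vector,
    'w::complex_algebra, 'p::complex_algebra, 'o::complex_algebra) calculus \<Rightarrow> ('q \<Rightarrow> 'o) \<Rightarrow> bool"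
  where "real_qpc C \<omega> \<longleftrightarrow> (\<forall>\<theta>. \<omega> (inv_star C \<theta>) = gstar (forms C) (\<omega> \<theta>))"

definition regular_qpc :: "'h::complex_algebra hopf \<Rightarrow>
    ('h, 'g::complex_vector, 'q::complex_vector, 'w::complex_algebra, 'p::complex_algebra, 'o::complex_algebra) calculus
    \<Rightarrow> ('q \<Rightarrow> 'o) \<Rightarrow> bool"
  where "regular_qpc H C \<omega> \<longleftrightarrow>
    (\<forall>\<theta> k. \<forall>\<phi> \<in> horizontal C \<inter> hpart (forms C) k.
      \<omega> \<theta> * \<phi> = (-1) ^ k *\<^sub>C tensor_lift (\<lambda>\<psi> h. \<psi> * \<omega> (diamond H C \<theta> h)) (hor_coact C \<phi>))"

definition multiplicative_qpc :: "'h::complex_algebra hopf \<Rightarrow>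
    ('h, 'g::complex_vector, 'q::complex_vector, 'w::complex_algebra, 'p::complex_algebra, 'o::complex_algebra) calculus
    \<Rightarrow> ('q \<Rightarrow> 'o) \<Rightarrow> bool"
  where "multiplicative_qpc H C \<omega> \<longleftrightarrow>
    (\<forall>g \<in> germ_ideal H C.
      tensor_lift (\<lambda>a b. \<omega> (germ H C a) * \<omega> (germ H C b)) (comult H g) = 0)"

section \<open>Quantum gauge transformations\<close>

text \<open>The group product is composition in the reverse order, so that the group acts from the right.\<close>

definition quantum_gauge_group :: "('h::complex_algebra, 'g::complex_vector, 'q::complex_vector,
    'w::complex_algebra, 'p::complex_algebra, 'o::complex_algebra) calculus \<Rightarrow> ('o \<Rightarrow> 'o) monoid"
  where "quantum_gauge_group C = \<lparr>
    carrier = {F.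
      clinear F \<and> bij F \<and>
      (\<forall>k. F ` hpart (forms C) k = hpart (forms C) k) \<and>
      (\<forall>\<mu>\<in>base_forms C. \<forall>w. F (\<mu> * w) = \<mu> * F w) \<and>
      F 1 = 1 \<and>
      (\<forall>w. tensor_map F id (forms_coact C w) = forms_coact C (F w))},
    monoid.mult = (\<lambda>F\<^sub>1 F\<^sub>2. F\<^sub>2 \<circ> F\<^sub>1),
    one = id\<rparr>"

definition preserves_star :: "'o::complex_algebra gda \<Rightarrow> ('o \<Rightarrow> 'o) \<Rightarrow> bool"
  where "preserves_star A F \<longleftrightarrow> (\<forall>w. F (gstar A w) = gstar A (F w))"

definition graded_algebra_morphism :: "'o::complex_algebra gda \<Rightarrow> ('o \<Rightarrow> 'o) \<Rightarrow> bool"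
  where "graded_algebra_morphism A F \<longleftrightarrow>
    clinear F \<and> F 1 = 1 \<and> (\<forall>w v. F (w * v) = F w * F v) \<and> (\<forall>k. F ` hpart A k \<subseteq> hpart A k)"

definition gauge_act :: "('o \<Rightarrow> 'o) \<Rightarrow> ('q \<Rightarrow> 'o) \<Rightarrow> ('q \<Rightarrow> 'o)"
  where "gauge_act F \<omega> = F \<circ> \<omega>"

definition right_group_action :: "('f, 'm) monoid_scheme \<Rightarrow> 'x set \<Rightarrow> ('f \<Rightarrow> 'x \<Rightarrow> 'x) \<Rightarrow> bool"
  where "right_group_action G X act \<longleftrightarrow>
    group G \<and>
    (\<forall>g\<in>carrier G. \<forall>x\<in>X. act g x \<in> X) \<and>
    (\<forall>x\<in>X. act \<one>\<^bsub>G\<^esub> x = x) \<and>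
    (\<forall>g\<in>carrier G. \<forall>h\<in>carrier G. \<forall>x\<in>X. act (g \<otimes>\<^bsub>G\<^esub> h) x = act h (act g x))"

end

(*
  The defining identities of connections, reality, regularity and multiplicativity involve only
  linear maps, the coaction on forms and products, so they are carried along by a map that
  commutes with the coaction.  For regularity, applied to a horizontal form phi = F psi, one needs
  that psi is horizontal and that the horizontal coaction of F psi is (F (x) id) of that of psi;
  the latter rests on the injectivity of Omega(P) (x) H -> Omega(P) (x) Gamma^, which holds because an
  injective linear map over a field has a linear left inverse.
*)
theory Submission
  imports Defs
begin

section \<open>Tensor products of linear maps\<close>

text \<open>Both sides are linear in \<open>t\<close>, so elementary tensors decide. The rule lets
  maps acting on different legs be interchanged, in particular \<open>F\<close> on the forms and the
  inclusion of H on the second leg.\<close>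

lemma tensor_map_comp:
  assumes "clinear f" "clinear g" "clinear f'" "clinear g'"
  shows "tensor_map f g (tensor_map f' g' t) = tensor_map (f \<circ> f') (g \<circ> g') t"
proof (rule clinear_eq_tensor[where f = "\<lambda>t. tensor_map f g (tensor_map f' g' t)"])
  have c: "clinear (f \<circ> f')" "clinear (g \<circ> g')"
    unfolding comp_def by (rule clinear_comp[OF assms(1,3)], rule clinear_comp[OF assms(2,4)])
  show "clinear (\<lambda>t. tensor_map f g (tensor_map f' g' t))"
    by (rule clinear_comp[OF clinear_tensor_map[OF assms(1,2)] clinear_tensor_map[OF assms(3,4)]])
  show "clinear (tensor_map (f \<circ> f') (g \<circ> g'))"
    by (rule clinear_tensor_map[OF c])
  show "tensor_map f g (tensor_map f' g' (a \<otimes>\<^sub>C b)) = tensor_map (f \<circ> f') (g \<circ> g') (a \<otimes>\<^sub>C b)" for a b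
    by (simp add: tensor_map_tens assms c)
qed

lemma tensor_map_id: "tensor_map id id t = t"
  by (rule clinear_eq_tensor[of _ "\<lambda>t. t"])
    (simp_all add: clinear_tensor_map tensor_map_tens clinear_id clinear_id[unfolded id_def])

text \<open>If \<open>g\<close> is a linear left inverse of \<open>f\<close>, then
  \<open>tensor_map id g\<close> is a left inverse of \<open>tensor_map id f\<close>. This makes the
  preimage chosen in \<open>hor_coact\<close> unique.\<close>

lemma inj_tensor_map_id:
  assumes "clinear f" "inj f"
  shows "inj (tensor_map id f)"
proof -
  interpret vector_space_pair "scaleC :: complex \<Rightarrow> 'a \<Rightarrow> 'a" "scaleC :: complex \<Rightarrow> 'b \<Rightarrow> 'b"
    by unfold_locales
  obtain g where g: "clinear g" "g \<circ> f = id"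
    using linear_injective_left_inverse[OF assms] by auto
  have "tensor_map id g (tensor_map id f t) = t" for t :: "('c, 'a) tensor"
    by (simp add: tensor_map_comp clinear_id assms g tensor_map_id)
  then show ?thesis
    by (rule inj_on_inverseI)
qed

section \<open>Linearity of the germ map and of the right action\<close>

text \<open>\<open>germ\<close> is chosen by \<open>inv_into\<close>, so linearity has to be earned:
  the chosen value is a genuine preimage because \<open>left_invariant_germ\<close> puts
  \<open>p g\<close> into the range of \<open>inv_incl C\<close>, and identities then follow from
  those of \<open>p\<close> by cancelling the injective linear map
  \<open>inv_incl C\<close>.\<close>

lemma clinear_germ:
  assumes H: "hopf_star_algebra H" and C: "differential_calculus H \<zeta> C"
  shows "clinear (germ H C)"
proof -
  define p where "p = (\<lambda>g. tensor_lift (\<lambda>a b. lact (calc C) (antipode H a) (fod (calc C) b)) (comult H g))"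
  have \<Gamma>: "bicovariant_star_calculus H (calc C)"
    and \<iota>: "clinear (inv_incl C)" "inj (inv_incl C)" "range (inv_incl C) = left_invariant (calc C)"
    using C by (simp_all add: differential_calculus_def)
  have l: "cbilinear (lact (calc C))" "clinear (antipode H)" "clinear (fod (calc C))" "clinear (comult H)"
    using H \<Gamma> by (simp_all add: bicovariant_star_calculus_def bimodule_def hopf_star_algebra_def star_hom_def)
  have p: "clinear p"
    unfolding p_def
    by (rule clinear_comp[OF clinear_tensor_lift[OF cbilinear_precomp[OF l(1-3)]] l(4)])
  have germ: "inv_incl C (germ H C g) = p g" for g
    using left_invariant_germ[OF H \<Gamma>, of g]
    by (simp add: germ_def p_def f_inv_into_f \<iota>(3))
  show ?thesis
    unfolding clinear_iff
  proof (intro conjI allI; rule injD[OF \<iota>(2)])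
    show "inv_incl C (germ H C (x + y)) = inv_incl C (germ H C x + germ H C y)" for x y
      by (simp add: germ clinear_add[OF \<iota>(1)] clinear_add[OF p])
    show "inv_incl C (germ H C (c *\<^sub>C x)) = inv_incl C (c *\<^sub>C germ H C x)" for c x
      by (simp add: germ clinear_scaleC[OF \<iota>(1)] clinear_scaleC[OF p])
  qed
qed

text \<open>For fixed \<theta> the chosen preimage \<open>h\<close> is a constant, which leaves
  \<open>germ H C\<close> composed with a linear map of the acting element. Regularity needs this to
  make its Sweedler summand bilinear.\<close>

lemma clinear_diamond:
  assumes H: "hopf_star_algebra H" and C: "differential_calculus H \<zeta> C"
  shows "clinear (diamond H C \<theta>)"
proof -
  define h where "h = inv_into UNIV (germ H C) \<theta>"
  have "clinear (\<lambda>g. h * g - counit H h *\<^sub>C g)"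
    by (simp add: clinear_iff scaleC_mult_right scaleC_add_right cvec.scale_right_diff_distrib
        cvec.scale_left_commute distrib_left)
  then have "clinear (\<lambda>g. germ H C (h * g - counit H h *\<^sub>C g))"
    by (rule clinear_comp[OF clinear_germ[OF assms]])
  moreover have "diamond H C \<theta> = (\<lambda>g. germ H C (h * g - counit H h *\<^sub>C g))"
    by (simp add: fun_eq_iff diamond_def Let_def h_def)
  ultimately show ?thesis
    by simp
qed

section \<open>The group of quantum gauge transformations\<close>

lemma gauge_carrier_iff:
  "F \<in> carrier (quantum_gauge_group C) \<longleftrightarrow>
    clinear F \<and> bij F \<and>
    (\<forall>k. F ` hpart (forms C) k = hpart (forms C) k) \<and>
    (\<forall>\<mu>\<in>base_forms C. \<forall>w. F (\<mu> * w) = \<mu> * F w) \<and>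
    F 1 = 1 \<and>
    (\<forall>w. tensor_map F id (forms_coact C w) = forms_coact C (F w))"
  by (simp add: quantum_gauge_group_def)

lemma gauge_comp:
  assumes F: "F \<in> carrier (quantum_gauge_group C)" and F': "F' \<in> carrier (quantum_gauge_group C)"
  shows "F' \<circ> F \<in> carrier (quantum_gauge_group C)"
proof -
  note f = F[unfolded gauge_carrier_iff] F'[unfolded gauge_carrier_iff]
  have "tensor_map (F' \<circ> F) id (forms_coact C w) = forms_coact C ((F' \<circ> F) w)" for w
    using tensor_map_comp[of F' id F id "forms_coact C w"] f by (simp add: clinear_id)
  then show ?thesis
    using f by (simp add: gauge_carrier_iff bij_comp clinear_iff flip: image_image)
qed

text \<open>Each identity for the inverse is the one for \<open>F\<close>, read at preimages: by
  \<open>eqI\<close> it suffices to compare the two sides after applying \<open>F\<close>. For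
  equivariance, the inverse is instead applied to the first leg of the identity for \<open>F\<close>
  at the preimage of \<open>w\<close>.\<close>

lemma gauge_inv:
  assumes F: "F \<in> carrier (quantum_gauge_group C)"
  shows "inv_into UNIV F \<in> carrier (quantum_gauge_group C)"
proof -
  note f = F[unfolded gauge_carrier_iff]
  have b: "bij F" and lin: "clinear F" using f by simp_all
  have FI: "F (inv_into UNIV F x) = x" and IF: "inv_into UNIV F (F x) = x" for x
    using b by (simp_all add: bij_is_surj surj_f_inv_f bij_is_inj)
  have eqI: "inv_into UNIV F x = y" if "x = F y" for x y
    using that IF by simp
  have lI: "clinear (inv_into UNIV F)"
    unfolding clinear_iff using lin by (auto intro!: eqI simp: clinear_iff FI)
  have deg: "inv_into UNIV F ` hpart (forms C) k = hpart (forms C) k" for k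
    using f b by (metis bij_is_inj image_inv_f_f)
  have "tensor_map (inv_into UNIV F) id (forms_coact C w) = forms_coact C (inv_into UNIV F w)" for w
  proof -
    have "forms_coact C w = tensor_map F id (forms_coact C (inv_into UNIV F w))"
      using f by (simp add: FI)
    moreover have "inv_into UNIV F \<circ> F = id"
      by (simp add: fun_eq_iff IF)
    ultimately show ?thesis
      by (simp add: tensor_map_comp lI lin clinear_id tensor_map_id)
  qed
  moreover have "inv_into UNIV F (\<mu> * w) = \<mu> * inv_into UNIV F w" if "\<mu> \<in> base_forms C" for \<mu> w
    by (rule eqI) (use f that in \<open>simp add: FI\<close>)
  moreover have "inv_into UNIV F 1 = 1"
    by (rule eqI) (use f in simp)
  ultimately show ?thesis
    unfolding gauge_carrier_iff using lI deg b by (simp add: bij_imp_bij_inv)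
qed

lemma group_gauge: "group (quantum_gauge_group C)"
proof (rule groupI)
  let ?G = "quantum_gauge_group C"
  show "\<one>\<^bsub>?G\<^esub> \<in> carrier ?G"
    by (simp add: quantum_gauge_group_def clinear_id tensor_map_id)
  fix x assume x: "x \<in> carrier ?G"
  \<comment> \<open>The group product reverses composition, so a left inverse in the group is a
    right inverse under \<circ>; surjectivity provides it.\<close>
  then have "x \<circ> inv_into UNIV x = id"
    by (metis bij_is_surj gauge_carrier_iff surj_iff)
  then show "\<exists>y\<in>carrier ?G. y \<otimes>\<^bsub>?G\<^esub> x = \<one>\<^bsub>?G\<^esub>"
    using gauge_inv[OF x] by (auto simp: quantum_gauge_group_def)
next
  fix x y assume "x \<in> carrier (quantum_gauge_group C)" "y \<in> carrier (quantum_gauge_group C)"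
  then have "y \<circ> x \<in> carrier (quantum_gauge_group C)"
    by (rule gauge_comp)
  then show "x \<otimes>\<^bsub>quantum_gauge_group C\<^esub> y \<in> carrier (quantum_gauge_group C)"
    by (simp add: quantum_gauge_group_def)
qed (simp_all add: quantum_gauge_group_def comp_assoc)

section \<open>Transport of connections and of their properties\<close>

text \<open>Equivariance turns the coaction of \<open>F (\<omega> \<theta>)\<close> into
  \<open>tensor_map F id\<close> of that of \<open>\<omega> \<theta>\<close>. On the adjoint term
  this replaces \<omega> by \<open>F \<circ> \<omega>\<close>; the inhomogeneous term is fixed since
  \<open>F 1 = 1\<close>.\<close>

lemma gauge_act_qpc:
  assumes C: "differential_calculus H \<zeta> C" and F: "F \<in> carrier (quantum_gauge_group C)"
    and w: "\<omega> \<in> qpc H C"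
  shows "gauge_act F \<omega> \<in> qpc H C"
proof -
  note f = F[unfolded gauge_carrier_iff]
  have \<iota>: "clinear (env0 (envel C))"
    using C by (simp add: differential_calculus_def universal_envelope_def Let_def star_hom_def)
  have lin: "clinear F" and \<omega>: "clinear \<omega>" using f w by (simp_all add: qpc_def)
  have F\<omega>: "clinear (F \<circ> \<omega>)"
    using clinear_comp[OF lin \<omega>] by (simp add: comp_def)
  have tens: "tensor_map F id (a \<otimes>\<^sub>C b) = F a \<otimes>\<^sub>C b" for a b
    using tensor_map_tens[OF lin clinear_id, of a b] by (simp only: id_apply)
  have co: "forms_coact C (F (\<omega> \<theta>)) =
      tensor_map id (env0 (envel C)) (tensor_map (F \<circ> \<omega>) id (adj H C \<theta>))
        + 1 \<otimes>\<^sub>C env1 (envel C) (inv_incl C \<theta>)" for \<theta>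
  proof -
    have "forms_coact C (F (\<omega> \<theta>)) = tensor_map F id (forms_coact C (\<omega> \<theta>))"
      using f by simp
    also have "forms_coact C (\<omega> \<theta>) =
        tensor_map id (env0 (envel C)) (tensor_map \<omega> id (adj H C \<theta>))
          + 1 \<otimes>\<^sub>C env1 (envel C) (inv_incl C \<theta>)"
      using w by (simp add: qpc_def)
    finally show ?thesis
      using f lin \<omega> \<iota> by (simp add: clinear_add[OF clinear_tensor_map[OF lin clinear_id]]
          tens tensor_map_comp F\<omega> clinear_id del: id_apply)
  qed
  have "F (\<omega> \<theta>) \<in> hpart (forms C) 1" for \<theta>
    using f w by (metis (mono_tags, lifting) imageI mem_Collect_eq qpc_def)
  then show ?thesis
    using co F\<omega> by (simp add: qpc_def gauge_act_def)
qed

text \<open>The reality equation for \<open>F \<circ> \<omega>\<close> is \<open>F\<close> applied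
  to both sides of the one for \<omega>; injectivity of \<open>F\<close> gives the converse.\<close>

lemma real_gauge_act_iff:
  assumes "F \<in> carrier (quantum_gauge_group C)" "preserves_star (forms C) F"
  shows "real_qpc C (gauge_act F \<omega>) \<longleftrightarrow> real_qpc C \<omega>"
proof -
  have "inj F"
    using assms(1) by (simp add: gauge_carrier_iff bij_is_inj)
  moreover have "gstar (forms C) (F w) = F (gstar (forms C) w)" for w
    using assms(2) by (simp add: preserves_star_def)
  ultimately show ?thesis
    by (simp add: real_qpc_def gauge_act_def inj_eq)
qed

lemma hor_coact_gauge:
  assumes C: "differential_calculus H \<zeta> C" and F: "F \<in> carrier (quantum_gauge_group C)"
    and \<psi>: "\<psi> \<in> horizontal C"
  shows "F \<psi> \<in> horizontal C" "hor_coact C (F \<psi>) = tensor_map F id (hor_coact C \<psi>)"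
proof -
  let ?\<iota> = "tensor_map id (env0 (envel C))"
  note f = F[unfolded gauge_carrier_iff]
  have \<iota>: "clinear (env0 (envel C))" "inj (env0 (envel C))"
    using C by (simp_all add: differential_calculus_def universal_envelope_def Let_def star_hom_def)
  have lin: "clinear F" using f by simp
  have "?\<iota> (hor_coact C \<psi>) = forms_coact C \<psi>"
    using \<psi> by (simp add: hor_coact_def horizontal_def f_inv_into_f)
  then have "forms_coact C (F \<psi>) = tensor_map F id (?\<iota> (hor_coact C \<psi>))"
    using f by simp
  also have "\<dots> = ?\<iota> (tensor_map F id (hor_coact C \<psi>))"
    by (simp add: tensor_map_comp lin \<iota> clinear_id)
  finally have e: "forms_coact C (F \<psi>) = ?\<iota> (tensor_map F id (hor_coact C \<psi>))" .
  then show "F \<psi> \<in> horizontal C"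
    by (simp add: horizontal_def)
  \<comment> \<open>The right-hand side is a preimage of the coaction by \<open>e\<close>, and
    injectivity forces \<open>inv_into\<close> to return it.\<close>
  show "hor_coact C (F \<psi>) = tensor_map F id (hor_coact C \<psi>)"
    unfolding hor_coact_def[of C "F \<psi>"] e by (rule inv_f_f[OF inj_tensor_map_id[OF \<iota>]])
qed

lemma regular_gauge_act:
  assumes H: "hopf_star_algebra H" and C: "differential_calculus H \<zeta> C"
    and F: "F \<in> carrier (quantum_gauge_group C)" and m: "\<And>w v. F (w * v) = F w * F v"
    and w: "\<omega> \<in> qpc H C" and reg: "regular_qpc H C \<omega>"
  shows "regular_qpc H C (gauge_act F \<omega>)"
  unfolding regular_qpc_def
proof (intro allI ballI)
  fix \<theta> k \<phi>
  assume \<phi>: "\<phi> \<in> horizontal C \<inter> hpart (forms C) k"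
  note f = F[unfolded gauge_carrier_iff]
  have lin: "clinear F" and \<omega>: "clinear \<omega>" using f w by (simp_all add: qpc_def)
  define \<psi> where "\<psi> = inv_into UNIV F \<phi>"
  have F\<psi>: "F \<psi> = \<phi>"
    using f by (simp add: \<psi>_def bij_is_surj surj_f_inv_f)
  \<comment> \<open>The inverse of \<open>F\<close> is itself a gauge transformation, so it
    preserves horizontality and degree.\<close>
  have "\<psi> \<in> horizontal C" "\<psi> \<in> hpart (forms C) k"
    using hor_coact_gauge(1)[OF C gauge_inv[OF F]] gauge_inv[OF F, unfolded gauge_carrier_iff] \<phi>
    by (auto simp: \<psi>_def)
  note \<psi> = this
  have d: "clinear (\<lambda>h. \<omega> (diamond H C \<theta> h))"
    by (rule clinear_comp[OF \<omega> clinear_diamond[OF H C]])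
  \<comment> \<open>\<open>tensor_lift\<close> can be manipulated only for bilinear summands:
    \<open>b\<close> serves to pull \<open>F\<close> out of the sum for \<omega>, \<open>b'\<close>
    to change variables in the sum for \<open>F \<circ> \<omega>\<close>.\<close>
  note b = cbilinear_precomp[OF cbilinear_times clinear_id d, unfolded id_apply]
  note b' = cbilinear_precomp[OF cbilinear_times clinear_id clinear_comp[OF lin d], unfolded id_apply]
  have "gauge_act F \<omega> \<theta> * \<phi> = F (\<omega> \<theta> * \<psi>)"
    by (simp add: gauge_act_def m F\<psi>)
  also have "\<omega> \<theta> * \<psi> = (-1) ^ k *\<^sub>C tensor_lift (\<lambda>\<psi> h. \<psi> * \<omega> (diamond H C \<theta> h)) (hor_coact C \<psi>)"
    using reg \<psi> by (simp add: regular_qpc_def)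
  also have "F \<dots> = (-1) ^ k *\<^sub>C
      tensor_lift (\<lambda>\<psi> h. F \<psi> * F (\<omega> (diamond H C \<theta> h))) (hor_coact C \<psi>)"
    by (simp add: clinear_scaleC[OF lin] tensor_lift_compose[OF lin b] m)
  \<comment> \<open>Change of variables: the factor \<open>F \<psi>\<close> in the summand is
    absorbed into the coaction, since that of \<phi> is \<open>tensor_map F id\<close> of that of
    \<psi>.\<close>
  also have "tensor_lift (\<lambda>\<psi> h. F \<psi> * F (\<omega> (diamond H C \<theta> h))) (hor_coact C \<psi>) =
      tensor_lift (\<lambda>\<psi> h. \<psi> * F (\<omega> (diamond H C \<theta> h))) (hor_coact C \<phi>)"
    using hor_coact_gauge(2)[OF C F \<psi>(1)] by (simp add: lift_map[OF b' lin clinear_id] F\<psi>)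
  finally show "gauge_act F \<omega> \<theta> * \<phi> =
      (-1) ^ k *\<^sub>C tensor_lift (\<lambda>\<psi> h. \<psi> * gauge_act F \<omega> (diamond H C \<theta> h)) (hor_coact C \<phi>)"
    by (simp add: gauge_act_def)
qed

text \<open>Multiplicativity and linearity pull \<open>F\<close> out of the Sweedler sum, so the sum
  for \<open>F \<circ> \<omega>\<close> is the image under \<open>F\<close> of the vanishing sum for
  \<omega>.\<close>

lemma multiplicative_gauge_act:
  assumes H: "hopf_star_algebra H" and C: "differential_calculus H \<zeta> C"
    and F: "clinear F" and m: "\<And>w v. F (w * v) = F w * F v"
    and \<omega>: "clinear \<omega>" and mult: "multiplicative_qpc H C \<omega>"
  shows "multiplicative_qpc H C (gauge_act F \<omega>)"
proof -
  note g = clinear_comp[OF \<omega> clinear_germ[OF H C]]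
  note b = cbilinear_precomp[OF cbilinear_times g g]
  have "F 0 = 0"
    using clinear_add[OF F, of 0 0] by simp
  then show ?thesis
    using mult by (simp add: multiplicative_qpc_def gauge_act_def flip: m tensor_lift_compose[OF F b])
qed

theorem theorem4p7:
  fixes G :: "('a::complex_algebra, 'c::complex_algebra, 'h::complex_algebra) cmqg"
    and \<zeta> :: "('p::complex_algebra, 'h) qpb"
    and C :: "('h, 'g::complex_vector, 'q::complex_vector, 'w::complex_algebra, 'p, 'o::complex_algebra) calculus"
    and F :: "'o \<Rightarrow> 'o"
  assumes "compact_matrix_quantum_group G"
    and "quantum_principal_bundle (dense_hopf G) \<zeta>"
    and "differential_calculus (dense_hopf G) \<zeta> C"
    and "F \<in> carrier (quantum_gauge_group C)"
  shows "(\<forall>\<omega> \<in> qpc (dense_hopf G) C. gauge_act F \<omega> \<in> qpc (dense_hopf G) C) \<and>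
    right_group_action (quantum_gauge_group C) (qpc (dense_hopf G) C) gauge_act \<and>
    (preserves_star (forms C) F \<longrightarrow>
      (\<forall>\<omega> \<in> qpc (dense_hopf G) C. real_qpc C (gauge_act F \<omega>) \<longleftrightarrow> real_qpc C \<omega>)) \<and>
    (graded_algebra_morphism (forms C) F \<longrightarrow>
      (\<forall>\<omega> \<in> qpc (dense_hopf G) C. regular_qpc (dense_hopf G) C \<omega> \<longrightarrow>
        regular_qpc (dense_hopf G) C (gauge_act F \<omega>))) \<and>
    (graded_algebra_morphism (forms C) F \<longrightarrow>
      (\<forall>\<omega> \<in> qpc (dense_hopf G) C. multiplicative_qpc (dense_hopf G) C \<omega> \<longrightarrow>
        multiplicative_qpc (dense_hopf G) C (gauge_act F \<omega>)))"
proof (intro conjI ballI impI)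
  have H: "hopf_star_algebra (dense_hopf G)"
    using assms(1) by (simp add: compact_matrix_quantum_group_def Let_def)
  note C = assms(3) and F = assms(4)
  \<comment> \<open>With the reversed product, the law of a right action is associativity of
    composition.\<close>
  show "right_group_action (quantum_gauge_group C) (qpc (dense_hopf G) C) gauge_act"
    unfolding right_group_action_def
    using group_gauge gauge_act_qpc[OF C]
    by (auto simp: quantum_gauge_group_def gauge_act_def comp_assoc)
  fix \<omega> assume \<omega>: "\<omega> \<in> qpc (dense_hopf G) C"
  show "gauge_act F \<omega> \<in> qpc (dense_hopf G) C"
    by (rule gauge_act_qpc[OF C F \<omega>])
  show "real_qpc C (gauge_act F \<omega>) \<longleftrightarrow> real_qpc C \<omega>" if "preserves_star (forms C) F"
    by (rule real_gauge_act_iff[OF F that])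
  assume "graded_algebra_morphism (forms C) F"
  then have m: "clinear F" "\<And>w v. F (w * v) = F w * F v"
    by (simp_all add: graded_algebra_morphism_def)
  show "regular_qpc (dense_hopf G) C (gauge_act F \<omega>)" if "regular_qpc (dense_hopf G) C \<omega>"
    by (rule regular_gauge_act[OF H C F m(2) \<omega> that])
  show "multiplicative_qpc (dense_hopf G) C (gauge_act F \<omega>)" if "multiplicative_qpc (dense_hopf G) C \<omega>"
    using \<omega> by (intro multiplicative_gauge_act[OF H C m _ that]) (simp add: qpc_def)
qed

end
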